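(* Let $1\le k<n$ be two integers. Assume $E\subset\mathbb R^n$ is a Souslin set which is not $\sigma$-finite with respect to $\mathcal H^k$. Then $E$ contains a closed subset $F$ such that $0<\mathcal H^k(F)<\infty$ and $F$ is purely $k$-unrectifiable, namely $\mathcal H^k(F\cap\Gamma)=0$ for every Lipschitz $k$-dimensional graph $\Gamma\subset\mathbb R^n$.
   Context: $\mathcal H^k$ denotes the $k$-dimensional Hausdorff measure. Souslin sets are also called analytic sets. A set is $\mathcal H^k$-$\sigma$-finite if it is a countable union of sets of finite $\mathcal H^k$ measure. A Lipschitz $k$-dimensional graph is a set of the form $\{x+g(x):x\in V\}$, where $V\subset\mathbb R^n$ is a $k$-dimensional linear subspace and $g:V\to V^\perp$ is Lipschitz. *)

theory Defs
  imports "HOL-Analysis.Analysis"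
begin

text \<open>
  Hausdorff measure as an outer measure on all subsets, with the normalising constant
  \<open>unit_ball_vol k / 2 ^ k\<close>, so that it agrees with Lebesgue measure on k-dimensional
  subspaces.  The covering sets are required to be bounded because \<^const>\<open>diameter\<close> is
  real-valued and carries no information for unbounded sets.  Empty covering sets
  contribute nothing (this only matters for \<open>k = 0\<close>, where \<open>0 ^ 0 = 1\<close>).
\<close>

definition hausdorff_weight :: "nat \<Rightarrow> 'a::metric_space set \<Rightarrow> ennreal" where
  "hausdorff_weight k C =
     (if C = {} then 0 else ennreal (unit_ball_vol (real k) * (diameter C / 2) ^ k))"

definition hausdorff_premeasure :: "nat \<Rightarrow> real \<Rightarrow> 'a::metric_space set \<Rightarrow> ennreal" where
  "hausdorff_premeasure k \<delta> A =
     (INF C \<in> {C :: nat \<Rightarrow> 'a set. A \<subseteq> (\<Union>i. C i) \<and> (\<forall>i. bounded (C i) \<and> diameter (C i) \<le> \<delta>)}.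
        \<Sum>i. hausdorff_weight k (C i))"

text \<open>The premeasure increases as \<open>\<delta>\<close> decreases, so the supremum is the limit as \<open>\<delta>\<close> tends to 0.\<close>

definition hausdorff_measure :: "nat \<Rightarrow> 'a::metric_space set \<Rightarrow> ennreal" where
  "hausdorff_measure k A = (SUP \<delta> \<in> {0<..}. hausdorff_premeasure k \<delta> A)"

definition hausdorff_sigma_finite :: "nat \<Rightarrow> 'a::metric_space set \<Rightarrow> bool" where
  "hausdorff_sigma_finite k E \<longleftrightarrow>
     (\<exists>A :: nat \<Rightarrow> 'a set. E = (\<Union>i. A i) \<and> (\<forall>i. hausdorff_measure k (A i) < \<infinity>))"

text \<open>
  Souslin sets are the results of the Souslin operation applied to closed sets: a scheme
  assigns a closed set to each finite sequence of naturals, and one takes the union over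
  all infinite sequences \<open>\<sigma>\<close> of the intersection over the nonempty initial segments of \<open>\<sigma>\<close>.
\<close>

definition souslin :: "'a::topological_space set \<Rightarrow> bool" where
  "souslin E \<longleftrightarrow>
     (\<exists>A :: nat list \<Rightarrow> 'a set. (\<forall>s. closed (A s)) \<and>
        E = (\<Union>\<sigma> :: nat \<Rightarrow> nat. \<Inter>m. A (map \<sigma> [0..<Suc m])))"

definition lipschitz_graph :: "nat \<Rightarrow> 'a::euclidean_space set \<Rightarrow> bool" where
  "lipschitz_graph k \<Gamma> \<longleftrightarrow>
     (\<exists>V g L. subspace V \<and> dim V = k \<and> g ` V \<subseteq> orthogonal_comp V \<and>
        L-lipschitz_on V g \<and> \<Gamma> = {x + g x | x. x \<in> V})"

definition purely_unrectifiable :: "nat \<Rightarrow> 'a::euclidean_space set \<Rightarrow> bool" where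
  "purely_unrectifiable k F \<longleftrightarrow>
     (\<forall>\<Gamma>. lipschitz_graph k \<Gamma> \<longrightarrow> hausdorff_measure k (F \<inter> \<Gamma>) = 0)"

end

(*
  Call sets that are sigma-finite for H^k small, and weigh a set by the cheapest cover, up to a
  small set, by dyadic cells Q of weight w(Q) = 2^(- k * level Q).  Since sets of bounded net measure
  are themselves small, a non-small set X is covered, up to a small set, by full cells, those for
  which no such cover of X inside Q is cheaper than Q itself.  Inside a full cell R, fullness survives
  both the passage to a large term of a sequence increasing to X (this handles Souslin sets) and the
  reduction of the weights of all cells of level at least l by a fixed factor, for l large.  Hence
  one can select in R finitely many tiny full cells whose total weight is almost w(R), is at most w(Q)
  in every cell Q, and is much smaller than w(Q) in every cell Q of level l.

  Iterating this gives a compact set F with 0 < H^k(F) < \<infinity>, together with scales r tending to 0 such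
  that every ball of radius r meets F in a set of measure o(r^k), uniformly in the centre.  A bounded
  piece of a Lipschitz graph is covered by O(r^(-k)) such balls, so it meets F in a null set.
*)
theory Submission
  imports Defs
begin

text \<open>A set of finite positive measure may lie in a Lipschitz graph, so the selection must use
  that the given set is not sigma-finite, and not just that it is large. This enters through the
  choice of what a cover may ignore. Whatever is covered at every scale with one bound on the total
  weight is small, and making the fine cells cheaper by a fixed factor changes that bound but not
  its finiteness. Hence a limit of contents along an increasing sequence, which could lose mass for
  plain covers, loses nothing here, and it may be taken with the cheaper weights at the same time.
  The factor is \<open>wr i\<close> at stage \<open>i\<close>, and the scale \<open>l i\<close> at
  which it begins is chosen anew each time; these factors, tending to 0, are the gain behind o(r^k).
  Only finitely many cells are kept at each stage, and they are full again, so that the step can be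
  repeated. No measure is put on the limit set: the upper bounds on the weight inside every cell,
  together with compactness and a count of neighbouring cells, play the role of the mass
  distribution principle.\<close>

section \<open>Contents modulo a sigma-ideal on a net of cells\<close>

text \<open>The intended instance has half-open dyadic cubes as cells, \<open>N = 2 ^ k\<close>, and
  sigma-finiteness as \<open>small\<close>. The geometry is only a tree of cells;
  \<open>small_if_covers\<close> is the single link between weights and the ideal.\<close>

locale net =
  fixes body :: "'c \<Rightarrow> 'a set" and lev :: "'c \<Rightarrow> nat" and N :: nat
    and small :: "'a set \<Rightarrow> bool"
  assumes N_pos: "N > 0"
    and body_nonempty: "body a \<noteq> {}"
    and nested: "\<lbrakk>lev a \<le> lev b; body a \<inter> body b \<noteq> {}\<rbrakk> \<Longrightarrow> body b \<subseteq> body a"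
    and same_level: "\<lbrakk>lev a = lev b; body a \<inter> body b \<noteq> {}\<rbrakk> \<Longrightarrow> a = b"
    and exhaust: "\<exists>a. lev a = j \<and> x \<in> body a"
    and finite_level: "finite {b. lev b = j \<and> body b \<subseteq> body a}"
    and countable_cells: "countable (UNIV :: 'c set)"
    and small_subset: "\<lbrakk>small X; Y \<subseteq> X\<rbrakk> \<Longrightarrow> small Y"
    and small_UN: "(\<And>n::nat. small (Z n)) \<Longrightarrow> small (\<Union>n. Z n)"
    and small_if_covers: "\<lbrakk>\<And>q. \<exists>\<C>. X \<subseteq> \<Union>(body ` \<C>) \<and> (\<forall>b\<in>\<C>. q \<le> lev b) \<and>
           emeasure (point_measure UNIV (\<lambda>b. ennreal (1 / real N ^ lev b))) \<C> \<le> B; B < \<infinity>\<rbrakk> \<Longrightarrow> small X"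
begin

definition wr :: "nat \<Rightarrow> real" where "wr j = 1 / real N ^ j"

abbreviation w :: "nat \<Rightarrow> ennreal" where "w j \<equiv> ennreal (wr j)"

text \<open>Written as a measure on cells so that additivity, subadditivity and continuity from
  below hold for infinite families without enumerating them.\<close>

definition W :: "(nat \<Rightarrow> ennreal) \<Rightarrow> 'c set \<Rightarrow> ennreal" where
  "W u \<C> = emeasure (point_measure UNIV (\<lambda>b. u (lev b))) \<C>"

definition below :: "'c \<Rightarrow> 'c \<Rightarrow> bool" where
  "below b a \<longleftrightarrow> lev a \<le> lev b \<and> body b \<subseteq> body a"

definition region :: "'c set \<Rightarrow> 'a set" where "region \<C> = \<Union>(body ` \<C>)"

definition cov :: "'a set \<Rightarrow> 'c set \<Rightarrow> bool" where
  "cov X \<C> \<longleftrightarrow> small (X - region \<C>)"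

definition content :: "(nat \<Rightarrow> ennreal) \<Rightarrow> 'a set \<Rightarrow> ennreal" where
  "content u X = (INF \<C> \<in> {\<C>. cov X \<C>}. W u \<C>)"

text \<open>Only the inequality that can fail is recorded; \<open>content_cell_le\<close> gives the
  other one.\<close>

definition full :: "'a set \<Rightarrow> 'c \<Rightarrow> bool" where
  "full X b \<longleftrightarrow> w (lev b) \<le> content w (X \<inter> body b)"

section \<open>Weights of cells and of families of cells\<close>

lemma wr_pos: "wr j > 0"
  using N_pos by (simp add: wr_def)

lemma wr_add: "wr (i + j) = wr i * wr j"
  by (simp add: wr_def power_add)

lemma wr_antimono: "i \<le> j \<Longrightarrow> wr j \<le> wr i"
  unfolding wr_def using N_pos by (intro divide_left_mono power_increasing) auto

lemma W_mono: "\<C> \<subseteq> \<D> \<Longrightarrow> W u \<C> \<le> W u \<D>"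
  unfolding W_def by (intro emeasure_mono) (auto simp: sets_point_measure)

lemma W_Un: "W u (\<C> \<union> \<D>) \<le> W u \<C> + W u \<D>"
  unfolding W_def by (intro emeasure_subadditive) (auto simp: sets_point_measure)

lemma W_Un_disjoint: "\<C> \<inter> \<D> = {} \<Longrightarrow> W u (\<C> \<union> \<D>) = W u \<C> + W u \<D>"
  unfolding W_def by (intro plus_emeasure[symmetric]) (auto simp: sets_point_measure)

lemma W_UN: "finite I \<Longrightarrow> W u (\<Union>i\<in>I. \<D> i) \<le> (\<Sum>i\<in>I. W u (\<D> i))"
  unfolding W_def by (intro emeasure_subadditive_finite) (auto simp: sets_point_measure)

lemma W_UN_disjoint:
  "finite I \<Longrightarrow> disjoint_family_on \<D> I \<Longrightarrow> (\<Sum>i\<in>I. W u (\<D> i)) = W u (\<Union>i\<in>I. \<D> i)"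
  unfolding W_def by (intro sum_emeasure) (auto simp: sets_point_measure)

lemma W_finite: "finite \<C> \<Longrightarrow> W u \<C> = (\<Sum>b\<in>\<C>. u (lev b))"
  unfolding W_def by (intro emeasure_point_measure_finite2) auto

lemma W_finite_w: "finite \<C> \<Longrightarrow> W w \<C> = ennreal (\<Sum>b\<in>\<C>. wr (lev b))"
  using wr_pos by (subst W_finite) (auto simp: less_imp_le)

lemma W_scale:
  assumes "\<And>b. b \<in> \<C> \<Longrightarrow> u (lev b) \<le> c * v (lev b)"
  shows "W u \<C> \<le> c * W v \<C>"
proof -
  have "W u \<C> = (\<integral>\<^sup>+b. u (lev b) * indicator \<C> b \<partial>count_space UNIV)"
    unfolding W_def point_measure_def by (subst emeasure_density) auto
  also have "\<dots> \<le> (\<integral>\<^sup>+b. c * (v (lev b) * indicator \<C> b) \<partial>count_space UNIV)"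
    using assms by (intro nn_integral_mono) (auto simp: indicator_def)
  also have "\<dots> = c * (\<integral>\<^sup>+b. v (lev b) * indicator \<C> b \<partial>count_space UNIV)"
    by (intro nn_integral_cmult) auto
  also have "\<dots> = c * W v \<C>"
    unfolding W_def point_measure_def by (subst emeasure_density) auto
  finally show ?thesis .
qed

lemma W_mono_weight: "(\<And>b. b \<in> \<C> \<Longrightarrow> u (lev b) \<le> v (lev b)) \<Longrightarrow> W u \<C> \<le> W v \<C>"
  using W_scale[of \<C> u 1 v] by simp

lemma W_incseq: "incseq \<D> \<Longrightarrow> W u (\<Union>n. \<D> n) = (SUP n. W u (\<D> n))"
  unfolding W_def by (intro SUP_emeasure_incseq[symmetric]) (auto simp: sets_point_measure)

lemma W_le_truncations:
  assumes "\<And>m. W u {b \<in> \<C>. lev b < m} \<le> B"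
  shows "W u \<C> \<le> B"
proof -
  have "\<C> = (\<Union>m. {b \<in> \<C>. lev b < m})" by auto
  moreover have "incseq (\<lambda>m. {b \<in> \<C>. lev b < m})" by (auto simp: incseq_def)
  ultimately have "W u \<C> = (SUP m. W u {b \<in> \<C>. lev b < m})" using W_incseq by metis
  then show ?thesis using assms by (auto intro: SUP_least)
qed

lemma W_ge_member: "b \<in> \<C> \<Longrightarrow> u (lev b) \<le> W u \<C>"
  using W_mono[of "{b}" \<C> u] by (simp add: W_finite)

lemma below_refl [simp]: "below b b"
  by (simp add: below_def)

lemma below_trans: "below a b \<Longrightarrow> below b c \<Longrightarrow> below a c"
  by (auto simp: below_def)

lemma below_antisym: "below a b \<Longrightarrow> lev a \<le> lev b \<Longrightarrow> a = b"
  using same_level[of a b] body_nonempty[of a] by (auto simp: below_def)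

lemma below_if_meets: "lev a \<le> lev b \<Longrightarrow> x \<in> body a \<Longrightarrow> x \<in> body b \<Longrightarrow> below b a"
  using nested[of a b] by (auto simp: below_def)

lemma below_body: "below b a \<Longrightarrow> x \<in> body b \<Longrightarrow> x \<in> body a"
  by (auto simp: below_def)

lemma below_common: "below b a \<Longrightarrow> below b c \<Longrightarrow> lev a \<le> lev c \<Longrightarrow> below c a"
  using body_nonempty[of b] below_if_meets[of a c] below_body by blast

lemma finite_below_less: "finite {b. below b a \<and> lev b < m}"
proof -
  have "{b. below b a \<and> lev b < m} \<subseteq> (\<Union>j<m. {b. lev b = j \<and> body b \<subseteq> body a})"
    by (auto simp: below_def)
  then show ?thesis by (rule finite_subset) (auto simp: finite_level)
qed

lemma small_empty: "small {}"
  by (rule small_if_covers[of _ 0]) (auto intro!: exI[of _ "{}"])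

lemma small_Un: "small X \<Longrightarrow> small Y \<Longrightarrow> small (X \<union> Y)"
proof -
  assume *: "small X" "small Y"
  have "small (\<Union>n::nat. if n = 0 then X else Y)" using * by (intro small_UN) auto
  moreover have "X \<union> Y \<subseteq> (\<Union>n::nat. if n = 0 then X else Y)" by force
  ultimately show ?thesis using small_subset by blast
qed

lemma small_UN_countable:
  assumes "countable I" "\<And>i. i \<in> I \<Longrightarrow> small (Z i)"
  shows "small (\<Union>i\<in>I. Z i)"
proof (cases "I = {}")
  case False
  have "small (\<Union>n. Z (from_nat_into I n))"
    using assms(2) from_nat_into[OF False] by (intro small_UN) auto
  then show ?thesis
    using range_from_nat_into[OF False assms(1)] by (metis UN_simps(10))
qed (simp add: small_empty)

lemma small_UN_finite: "finite I \<Longrightarrow> (\<And>i. i \<in> I \<Longrightarrow> small (Z i)) \<Longrightarrow> small (\<Union>i\<in>I. Z i)"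
  using small_UN_countable[OF countable_finite] .

section \<open>Contents modulo small sets, and disjoint families of maximal cells\<close>

lemma content_le: "cov X \<C> \<Longrightarrow> content u X \<le> W u \<C>"
  unfolding content_def by (auto intro: INF_lower)

lemma content_greatest: "(\<And>\<C>. cov X \<C> \<Longrightarrow> B \<le> W u \<C>) \<Longrightarrow> B \<le> content u X"
  unfolding content_def by (auto intro: INF_greatest)

lemma content_lessD: "content u X < B \<Longrightarrow> \<exists>\<C>. cov X \<C> \<and> W u \<C> < B"
  unfolding content_def by (auto simp: INF_less_iff)

lemma content_mono:
  assumes "X \<subseteq> Y" "\<And>j. u j \<le> v j"
  shows "content u X \<le> content v Y"
proof (rule content_greatest)
  fix \<C> assume "cov Y \<C>"
  then have "cov X \<C>" using assms(1) small_subset unfolding cov_def by (meson Diff_mono subset_refl)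
  then have "content u X \<le> W u \<C>" by (rule content_le)
  also have "\<dots> \<le> W v \<C>" using assms(2) by (intro W_mono_weight)
  finally show "content u X \<le> W v \<C>" .
qed

lemma content_cell_le: "content u (X \<inter> body b) \<le> u (lev b)"
proof -
  have "X \<inter> body b - region {b} = {}" by (auto simp: region_def)
  then have "cov (X \<inter> body b) {b}" unfolding cov_def by (metis small_empty)
  from content_le[OF this, of u] show ?thesis by (simp add: W_finite)
qed

lemma content_empty: "content u {} = 0"
proof -
  have "cov {} {}" by (simp add: cov_def small_empty)
  from content_le[OF this, of u] show ?thesis by (simp add: W_finite)
qed

text \<open>A cell of the cover that meets \<open>body Q\<close> without lying strictly inside has
  level at most \<open>lev Q\<close>. Its weight alone would then be at least
  \<open>u (lev Q)\<close>, which the total excludes.\<close>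

lemma cov_restrict_strict:
  assumes "antimono u" "cov (X \<inter> body Q) \<C>" "W u \<C> < u (lev Q)"
  shows "cov (X \<inter> body Q) {b \<in> \<C>. below b Q \<and> lev Q < lev b}"
proof -
  have "X \<inter> body Q - region {b \<in> \<C>. below b Q \<and> lev Q < lev b} \<subseteq> X \<inter> body Q - region \<C>"
  proof (rule subsetI, rule ccontr)
    fix x assume x: "x \<in> X \<inter> body Q - region {b \<in> \<C>. below b Q \<and> lev Q < lev b}"
      and "x \<notin> X \<inter> body Q - region \<C>"
    then obtain b where *: "x \<in> body Q" "b \<in> \<C>" "x \<in> body b" by (auto simp: region_def)
    have "x \<notin> body b" if "below b Q" "lev Q < lev b" using x that * by (auto simp: region_def)
    with * have "\<not> lev Q < lev b" using below_if_meets[of Q b x] by auto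
    then have "u (lev Q) \<le> u (lev b)" using assms(1) by (auto simp: antimono_def)
    also have "\<dots> \<le> W u \<C>" using * by (intro W_ge_member)
    finally show False using assms(3) by auto
  qed
  then show ?thesis using assms(2) small_subset unfolding cov_def by blast
qed

text \<open>Cells are nested or disjoint and levels are natural numbers, so passing to maximal cells
  keeps the region and makes the family disjoint.\<close>

definition maxs :: "'c set \<Rightarrow> 'c set" where
  "maxs \<C> = {b \<in> \<C>. \<forall>a\<in>\<C>. below b a \<longrightarrow> a = b}"

lemma maxs_subset: "maxs \<C> \<subseteq> \<C>"
  by (auto simp: maxs_def)

lemma below_maxs:
  assumes "b \<in> \<C>"
  shows "\<exists>a\<in>maxs \<C>. below b a"
proof -
  define P where "P = (\<lambda>a. a \<in> \<C> \<and> below b a)"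
  have "P b" using assms by (simp add: P_def)
  then obtain a where a: "P a" "\<And>c. P c \<Longrightarrow> lev a \<le> lev c"
    using ex_has_least_nat[of P b lev] by auto
  have "a \<in> maxs \<C>"
    using a below_trans below_antisym unfolding maxs_def P_def by blast
  then show ?thesis using a by (auto simp: P_def)
qed

lemma region_maxs: "region (maxs \<C>) = region \<C>"
proof
  show "region (maxs \<C>) \<subseteq> region \<C>" using maxs_subset by (auto simp: region_def)
  show "region \<C> \<subseteq> region (maxs \<C>)"
    using below_maxs by (fastforce simp: region_def below_def)
qed

lemma maxs_eq_if_meets:
  assumes "a \<in> maxs \<C>" "b \<in> maxs \<C>" "x \<in> body a" "x \<in> body b"
  shows "a = b"
proof -
  have "below a b \<or> below b a"
    using below_if_meets[OF _ assms(3,4)] below_if_meets[OF _ assms(4,3)] nat_le_linear by blast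
  then show ?thesis using assms(1,2) unfolding maxs_def by blast
qed

lemma disjoint_below_maxs: "H \<subseteq> maxs \<C> \<Longrightarrow> disjoint_family_on (\<lambda>b. {a \<in> \<D>. below a b}) H"
proof (unfold disjoint_family_on_def, intro ballI impI equals0I)
  fix a b c assume H: "H \<subseteq> maxs \<C>" "a \<in> H" "b \<in> H" "a \<noteq> b"
    and "c \<in> {d \<in> \<D>. below d a} \<inter> {d \<in> \<D>. below d b}"
  moreover obtain x where "x \<in> body c" using body_nonempty by blast
  ultimately have "x \<in> body a" "x \<in> body b" using below_body by auto
  then show False using maxs_eq_if_meets H by blast
qed

subsection \<open>Increasing sets and weights\<close>

text \<open>The weight \<open>w\<close> made cheaper by the factor \<open>wr e\<close> from level
  \<open>l\<close> on. It stays antimonotone, is comparable to \<open>w\<close> with a constant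
  independent of \<open>l\<close>, and at each fixed level agrees with \<open>w\<close> once
  \<open>l\<close> is large.\<close>

definition cut :: "nat \<Rightarrow> nat \<Rightarrow> nat \<Rightarrow> ennreal" where
  "cut e l j = (if j < l then w j else w (j + e))"

lemma cut_le_w: "cut e l j \<le> w j"
  by (auto simp: cut_def intro!: ennreal_leI wr_antimono)

lemma cut_antimono: "antimono (cut e l)"
  by (auto simp: cut_def antimono_def intro!: ennreal_leI wr_antimono)

lemma cut_mono: "l \<le> l' \<Longrightarrow> cut e l j \<le> cut e l' j"
  by (auto simp: cut_def intro!: ennreal_leI wr_antimono)

lemma w_le_cut: "w j \<le> ennreal (1 / wr e) * cut e l j"
proof -
  have "w j \<le> ennreal (1 / wr e) * w (j + e)"
    using wr_pos[of e] wr_pos[of j] by (simp add: wr_add ennreal_mult[symmetric])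
  also have "\<dots> \<le> ennreal (1 / wr e) * cut e l j"
    by (intro mult_left_mono) (auto simp: cut_def intro!: ennreal_leI wr_antimono)
  finally show ?thesis .
qed

text \<open>One index \<open>l\<close> drives both the term of the sequence and the level where
  weights are reduced, so one monotone limit handles both.\<close>

definition limc :: "nat \<Rightarrow> (nat \<Rightarrow> 'a set) \<Rightarrow> 'c \<Rightarrow> ennreal" where
  "limc e X b = (SUP l. content (cut e l) (X l \<inter> body b))"

definition tight :: "nat \<Rightarrow> (nat \<Rightarrow> 'a set) \<Rightarrow> 'c \<Rightarrow> bool" where
  "tight e X b \<longleftrightarrow> w (lev b) \<le> limc e X b"

lemma content_cut_le_limc: "content (cut e l) (X l \<inter> body b) \<le> limc e X b"
  unfolding limc_def by (rule SUP_upper) simp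

lemma incseq_content_cut: "incseq X \<Longrightarrow> incseq (\<lambda>l. content (cut e l) (X l \<inter> body b))"
  by (intro incseq_SucI content_mono cut_mono) (auto simp: incseq_Suc_iff)

text \<open>A cell that is not tight has, at every large scale, a cover by strictly smaller cells that
  weighs less than the cell itself; replacing it repeatedly pushes the non-tight cells of a cover
  down to any given level.\<close>

lemma refine_cover:
  assumes "limc e X Q < \<eta>" "\<eta> \<le> w (lev Q)" "lev Q \<le> q" "q \<le> l" "lev Q < l"
  shows "\<exists>\<C>. cov (X l \<inter> body Q) \<C> \<and> W (cut e l) \<C> \<le> \<eta> \<and> (\<forall>b\<in>\<C>. below b Q \<and> (q \<le> lev b \<or> tight e X b))"
  using assms(3,4)
proof (induction q rule: dec_induct)
  case base
  have "content (cut e l) (X l \<inter> body Q) < \<eta>"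
    using content_cut_le_limc assms(1) by (rule le_less_trans)
  then obtain \<C> where \<C>: "cov (X l \<inter> body Q) \<C>" "W (cut e l) \<C> < \<eta>"
    using content_lessD by blast
  moreover have "W (cut e l) \<C> < cut e l (lev Q)"
    using \<C>(2) assms(2,5) by (simp add: cut_def less_le_trans)
  ultimately have "cov (X l \<inter> body Q) {b \<in> \<C>. below b Q \<and> lev Q < lev b}"
    using cov_restrict_strict[OF cut_antimono] by blast
  moreover have "W (cut e l) {b \<in> \<C>. below b Q \<and> lev Q < lev b} \<le> W (cut e l) \<C>"
    by (rule W_mono) auto
  ultimately show ?case
    using \<C>(2) by (intro exI[of _ "{b \<in> \<C>. below b Q \<and> lev Q < lev b}"]) auto
next
  case (step q)
  then have "q \<le> l" by simp
  with step.IH obtain \<C> where \<C>: "cov (X l \<inter> body Q) \<C>" "W (cut e l) \<C> \<le> \<eta>"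
    "\<And>b. b \<in> \<C> \<Longrightarrow> below b Q \<and> (q \<le> lev b \<or> tight e X b)"
    by blast
  \<comment> \<open>The cells that violate the claim for \<open>Suc q\<close> are those of level
    exactly \<open>q\<close> that are not tight; inside \<open>Q\<close> there are finitely
    many.\<close>
  define B where "B = {b \<in> \<C>. lev b = q \<and> \<not> tight e X b}"
  have "B \<subseteq> {b. below b Q \<and> lev b < Suc q}" using \<C>(3) by (auto simp: B_def)
  then have finB: "finite B" using finite_below_less finite_subset by blast
  have "\<exists>\<D>. cov (X l \<inter> body b) \<D> \<and> W (cut e l) \<D> \<le> cut e l (lev b) \<and> (\<forall>a\<in>\<D>. below a b \<and> lev b < lev a)"
    if "b \<in> B" for b
  proof -
    \<comment> \<open>At level \<open>q < l\<close> the weight is not yet reduced, so failure of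
      tightness yields a cover strictly cheaper than \<open>b\<close> in the weight
      \<open>cut e l\<close>.\<close>
    have "limc e X b < w (lev b)" "lev b < l" using that step by (auto simp: B_def tight_def)
    then have "content (cut e l) (X l \<inter> body b) < cut e l (lev b)"
      using le_less_trans[OF content_cut_le_limc] by (simp add: cut_def)
    then obtain \<D> where \<D>: "cov (X l \<inter> body b) \<D>" "W (cut e l) \<D> < cut e l (lev b)"
      using content_lessD by blast
    then have "cov (X l \<inter> body b) {a \<in> \<D>. below a b \<and> lev b < lev a}"
      using cov_restrict_strict[OF cut_antimono] by blast
    moreover have "W (cut e l) {a \<in> \<D>. below a b \<and> lev b < lev a} \<le> W (cut e l) \<D>"
      by (rule W_mono) auto
    ultimately show ?thesis
      using \<D>(2) by (intro exI[of _ "{a \<in> \<D>. below a b \<and> lev b < lev a}"]) auto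
  qed
  then obtain \<D> where \<D>: "\<And>b. b \<in> B \<Longrightarrow> cov (X l \<inter> body b) (\<D> b)"
    "\<And>b. b \<in> B \<Longrightarrow> W (cut e l) (\<D> b) \<le> cut e l (lev b)"
    "\<And>a b. b \<in> B \<Longrightarrow> a \<in> \<D> b \<Longrightarrow> below a b \<and> lev b < lev a"
    by metis
  let ?E = "(\<C> - B) \<union> (\<Union>b\<in>B. \<D> b)"
  have "X l \<inter> body Q - region ?E \<subseteq>
      (X l \<inter> body Q - region \<C>) \<union> (\<Union>b\<in>B. X l \<inter> body b - region (\<D> b))"
    by (auto simp: region_def)
  moreover have "small ((X l \<inter> body Q - region \<C>) \<union> (\<Union>b\<in>B. X l \<inter> body b - region (\<D> b)))"
    using \<C>(1) \<D>(1) finB by (intro small_Un small_UN_finite) (auto simp: cov_def)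
  ultimately have "cov (X l \<inter> body Q) ?E" unfolding cov_def by (rule small_subset[rotated])
  moreover have "W (cut e l) ?E \<le> \<eta>"
  proof -
    have "W (cut e l) ?E \<le> W (cut e l) (\<C> - B) + (\<Sum>b\<in>B. W (cut e l) (\<D> b))"
      using W_Un W_UN[OF finB] by (meson add_left_mono order_trans)
    also have "\<dots> \<le> W (cut e l) (\<C> - B) + W (cut e l) B"
      using \<D>(2) by (intro add_left_mono) (simp add: W_finite[OF finB] sum_mono)
    also have "\<dots> = W (cut e l) ((\<C> - B) \<union> B)" by (intro W_Un_disjoint[symmetric]) auto
    also have "(\<C> - B) \<union> B = \<C>" by (auto simp: B_def)
    finally show ?thesis using \<C>(2) by (rule order_trans)
  qed
  moreover have "below b Q \<and> (Suc q \<le> lev b \<or> tight e X b)" if b: "b \<in> ?E" for b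
  proof (cases "b \<in> \<C> - B")
    case True
    then show ?thesis using \<C>(3)[of b] by (auto simp: B_def)
  next
    case False
    then obtain a where a: "a \<in> B" "b \<in> \<D> a" using b by auto
    then have "below a Q" "lev a = q" using \<C>(3) by (auto simp: B_def)
    then show ?thesis using \<D>(3)[OF a] below_trans by (auto simp: Suc_le_eq)
  qed
  ultimately show ?case by blast
qed

text \<open>Refinement down to level \<open>l\<close> itself leaves only tight cells and cells of
  level at least \<open>l\<close>. The weight bound is independent of \<open>l\<close>, also after
  returning from \<open>cut e l\<close> to \<open>w\<close> by the constant \<open>1 / wr e\<close>,
  so what the tight cells miss satisfies \<open>small_if_covers\<close>.\<close>

lemma small_off_tight:
  assumes "incseq X"
  shows "small ((\<Union>l. X l) \<inter> body Q - region {b. below b Q \<and> tight e X b})"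
proof (cases "tight e X Q")
  case True
  then have "body Q \<subseteq> region {b. below b Q \<and> tight e X b}"
    unfolding region_def by (intro UN_upper) simp
  then have "(\<Union>l. X l) \<inter> body Q - region {b. below b Q \<and> tight e X b} = {}" by blast
  then show ?thesis by (metis small_empty)
next
  case False
  let ?T = "{b. below b Q \<and> tight e X b}"
  have lt: "limc e X Q < w (lev Q)" using False by (auto simp: tight_def)
  have "\<forall>l. lev Q < l \<longrightarrow> (\<exists>\<C>. cov (X l \<inter> body Q) \<C> \<and> W (cut e l) \<C> \<le> w (lev Q) \<and>
      (\<forall>b\<in>\<C>. below b Q \<and> (l \<le> lev b \<or> tight e X b)))"
    using refine_cover[OF lt order_refl] by auto
  then obtain \<C> where \<C>: "\<And>l. lev Q < l \<Longrightarrow> cov (X l \<inter> body Q) (\<C> l)"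
    "\<And>l. lev Q < l \<Longrightarrow> W (cut e l) (\<C> l) \<le> w (lev Q)"
    "\<And>l b. lev Q < l \<Longrightarrow> b \<in> \<C> l \<Longrightarrow> below b Q \<and> (l \<le> lev b \<or> tight e X b)"
    by metis
  \<comment> \<open>The exceptional sets of all covers are removed together; outside
    \<open>R\<close> the covers are genuine ones.\<close>
  define R where "R = (\<Union>l\<in>{lev Q<..}. X l \<inter> body Q - region (\<C> l))"
  have "small R" unfolding R_def
    using \<C>(1) by (intro small_UN_countable) (auto simp: cov_def)
  have "small (X m \<inter> body Q - region ?T - R)" for m
  proof (rule small_if_covers)
    fix q
    define l where "l = Suc (lev Q + m + q)"
    have l: "lev Q < l" "m \<le> l" "q \<le> l" by (auto simp: l_def)
    let ?D = "{b \<in> \<C> l. l \<le> lev b}"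
    have "X m \<inter> body Q - region ?T - R \<subseteq> \<Union>(body ` ?D)"
    proof
      fix x assume x: "x \<in> X m \<inter> body Q - region ?T - R"
      then have "x \<in> X l \<inter> body Q" using incseqD[OF assms l(2)] by auto
      with x l(1) have "x \<in> region (\<C> l)" by (auto simp: R_def)
      then obtain b where b: "b \<in> \<C> l" "x \<in> body b" by (auto simp: region_def)
      with x \<C>(3)[OF l(1), of b] show "x \<in> \<Union>(body ` ?D)" by (auto simp: region_def)
    qed
    moreover have "W w ?D \<le> ennreal (1 / wr e) * w (lev Q)"
    proof -
      have "W w ?D \<le> ennreal (1 / wr e) * W (cut e l) ?D" by (intro W_scale w_le_cut)
      also have "\<dots> \<le> ennreal (1 / wr e) * W (cut e l) (\<C> l)" by (intro mult_left_mono W_mono) auto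
      also have "\<dots> \<le> ennreal (1 / wr e) * w (lev Q)" using \<C>(2)[OF l(1)] by (intro mult_left_mono) auto
      finally show ?thesis .
    qed
    ultimately show "\<exists>\<C>. X m \<inter> body Q - region ?T - R \<subseteq> \<Union>(body ` \<C>) \<and> (\<forall>b\<in>\<C>. q \<le> lev b) \<and>
        emeasure (point_measure UNIV (\<lambda>b. ennreal (1 / real N ^ lev b))) \<C>
        \<le> ennreal (1 / wr e) * w (lev Q)"
      using l(3) unfolding W_def wr_def[symmetric] by (intro exI[of _ ?D]) auto
  qed (simp add: ennreal_mult_less_top)
  then have "small ((\<Union>m. X m \<inter> body Q - region ?T - R) \<union> R)"
    using \<open>small R\<close> by (intro small_Un small_UN)
  then show ?thesis by (rule small_subset) auto
qed

text \<open>Finitely many maximal tight cells have levels below some \<open>m\<close>. A cover by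
  tight cells and cells of level at least \<open>m\<close> contains no cell strictly larger than one
  of them, so it splits into covers of each of these disjoint cells, and their contents add up to at
  most \<open>\<eta>\<close>. In the limit in \<open>l\<close> the contents become values of
  \<open>limc\<close>, bounded below by tightness.\<close>

lemma W_maxs_tight_le:
  assumes "incseq X" "limc e X Q < \<eta>" "\<eta> \<le> w (lev Q)"
  shows "W w (maxs {b. below b Q \<and> tight e X b}) \<le> \<eta>"
proof (rule W_le_truncations)
  fix m
  let ?T = "{b. below b Q \<and> tight e X b}"
  define H where "H = {b \<in> maxs ?T. lev b < m}"
  have H: "H \<subseteq> maxs ?T" "H \<subseteq> {b. below b Q \<and> lev b < m}" using maxs_subset by (auto simp: H_def)
  then have finH: "finite H" using finite_below_less finite_subset by blast
  have "(\<Sum>b\<in>H. content (cut e l) (X l \<inter> body b)) \<le> \<eta>" for l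
  proof -
    \<comment> \<open>At least \<open>l\<close>, for monotonicity, and beyond
      \<open>m + lev Q\<close>, the level to which \<open>refine_cover\<close> is to push the
      non-tight cells.\<close>
    define l' where "l' = Suc (l + m + lev Q)"
    obtain \<C> where \<C>: "cov (X l' \<inter> body Q) \<C>" "W (cut e l') \<C> \<le> \<eta>"
      "\<And>b. b \<in> \<C> \<Longrightarrow> below b Q \<and> (m + lev Q \<le> lev b \<or> tight e X b)"
      using refine_cover[OF assms(2,3), of "m + lev Q" l'] unfolding l'_def by auto
    have "content (cut e l') (X l' \<inter> body b) \<le> W (cut e l') {a \<in> \<C>. below a b}" if "b \<in> H" for b
    proof (rule content_le)
      have b: "b \<in> maxs ?T" "lev b < m" "below b Q" using that H by (auto simp: H_def)
      have "X l' \<inter> body b - region {a \<in> \<C>. below a b} \<subseteq> X l' \<inter> body Q - region \<C>"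
      proof
        fix x assume x: "x \<in> X l' \<inter> body b - region {a \<in> \<C>. below a b}"
        have "x \<notin> body a" if a: "a \<in> \<C>" for a
        proof
          assume "x \<in> body a"
          then have "\<not> below a b" using x a by (auto simp: region_def)
          then have "\<not> lev b \<le> lev a" using x \<open>x \<in> body a\<close> below_if_meets by blast
          then have "below b a" "tight e X a" "a \<noteq> b" "below a Q"
            using x \<open>x \<in> body a\<close> below_if_meets[of a b x] \<C>(3)[OF a] b(2) by auto
          then show False using b(1) by (auto simp: maxs_def)
        qed
        then show "x \<in> X l' \<inter> body Q - region \<C>"
          using x below_body[OF b(3)] by (auto simp: region_def)
      qed
      then show "cov (X l' \<inter> body b) {a \<in> \<C>. below a b}"
        using \<C>(1) small_subset unfolding cov_def by blast
    qed
    then have "(\<Sum>b\<in>H. content (cut e l') (X l' \<inter> body b)) \<le> (\<Sum>b\<in>H. W (cut e l') {a \<in> \<C>. below a b})"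
      by (rule sum_mono)
    also have "\<dots> = W (cut e l') (\<Union>b\<in>H. {a \<in> \<C>. below a b})"
      by (rule W_UN_disjoint[OF finH disjoint_below_maxs[OF H(1)]])
    also have "\<dots> \<le> W (cut e l') \<C>" by (rule W_mono) auto
    also have "\<dots> \<le> \<eta>" by (rule \<C>(2))
    finally have "(\<Sum>b\<in>H. content (cut e l') (X l' \<inter> body b)) \<le> \<eta>" .
    moreover have "(\<Sum>b\<in>H. content (cut e l) (X l \<inter> body b)) \<le> (\<Sum>b\<in>H. content (cut e l') (X l' \<inter> body b))"
      by (intro sum_mono incseqD[OF incseq_content_cut[OF assms(1)]]) (simp add: l'_def)
    ultimately show ?thesis by (rule order_trans[rotated])
  qed
  then have "(SUP l. \<Sum>b\<in>H. content (cut e l) (X l \<inter> body b)) \<le> \<eta>" by (rule SUP_least)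
  then have "(\<Sum>b\<in>H. limc e X b) \<le> \<eta>"
    unfolding limc_def using incseq_content_cut[OF assms(1)] by (subst (asm) ennreal_SUP_sum) auto
  moreover have "W w H \<le> (\<Sum>b\<in>H. limc e X b)"
    using H(1) by (subst W_finite[OF finH]) (intro sum_mono, auto simp: maxs_def tight_def)
  ultimately show "W w {b \<in> maxs ?T. lev b < m} \<le> \<eta>" unfolding H_def by (rule order_trans[rotated])
qed

text \<open>Otherwise the maximal tight cells would cover the union inside \<open>Q\<close>, up to a
  small set, with total weight at most some \<open>\<eta> < w (lev Q)\<close>. This is how fullness
  survives both the passage to a term of the sequence and the cheaper weights.\<close>

lemma tight_if_full:
  assumes "incseq X" "full (\<Union>l. X l) Q"
  shows "tight e X Q"
proof (rule ccontr)
  assume "\<not> tight e X Q"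
  then have "limc e X Q < w (lev Q)" by (auto simp: tight_def)
  then obtain \<eta> where \<eta>: "limc e X Q < \<eta>" "\<eta> < w (lev Q)" using dense by blast
  let ?T = "{b. below b Q \<and> tight e X b}"
  have "cov ((\<Union>l. X l) \<inter> body Q) (maxs ?T)"
    using small_off_tight[OF assms(1)] unfolding cov_def region_maxs .
  then have "content w ((\<Union>l. X l) \<inter> body Q) \<le> W w (maxs ?T)" by (rule content_le)
  also have "\<dots> \<le> \<eta>" using W_maxs_tight_le[OF assms(1) \<eta>(1)] \<eta>(2) by auto
  finally show False using \<eta>(2) assms(2) unfolding full_def by auto
qed

lemma eventually_content_cut:
  assumes "incseq X" "full (\<Union>l. X l) Q" "\<eta> < w (lev Q)"
  shows "\<forall>\<^sub>F l in sequentially. \<eta> < content (cut e l) (X l \<inter> body Q)"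
proof -
  have "\<eta> < limc e X Q" using tight_if_full[OF assms(1,2)] assms(3) unfolding tight_def
    by (rule less_le_trans[rotated])
  then obtain l0 where "\<eta> < content (cut e l0) (X l0 \<inter> body Q)"
    unfolding limc_def less_SUP_iff by blast
  then show ?thesis
    using incseqD[OF incseq_content_cut[OF assms(1)]] less_le_trans
    by (intro eventually_sequentiallyI[of l0]) blast
qed

text \<open>Fullness is tightness for a constant sequence without reduction (\<open>e = 0\<close>),
  so \<open>small_off_tight\<close> applies in each of the countably many cells of level
  \<open>p\<close>.\<close>

lemma small_off_full: "small (X - region {b. p \<le> lev b \<and> full X b})"
proof -
  have cut0: "cut 0 l = w" for l by (auto simp: cut_def)
  have *: "tight 0 (\<lambda>_. X) b \<longleftrightarrow> full X b" for b
    by (simp add: tight_def full_def limc_def cut0)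
  have "small (\<Union>Q\<in>{Q. lev Q = p}. X \<inter> body Q - region {b. below b Q \<and> full X b})"
    using small_off_tight[of "\<lambda>_. X" _ 0] countable_cells countable_subset[OF subset_UNIV]
    by (intro small_UN_countable) (auto simp: *)
  then show ?thesis
  proof (rule small_subset, intro subsetI)
    fix x assume x: "x \<in> X - region {b. p \<le> lev b \<and> full X b}"
    obtain Q where Q: "lev Q = p" "x \<in> body Q" using exhaust by blast
    then show "x \<in> (\<Union>Q\<in>{Q. lev Q = p}. X \<inter> body Q - region {b. below b Q \<and> full X b})"
      using x by (auto simp: region_def below_def)
  qed
qed

subsection \<open>Selection of full cells\<close>

definition mass :: "'c set \<Rightarrow> 'c \<Rightarrow> real" where
  "mass S Q = (\<Sum>b | b \<in> S \<and> below b Q. wr (lev b))"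

lemma W_w_below: "finite S \<Longrightarrow> W w {b \<in> S. below b Q} = ennreal (mass S Q)"
  unfolding mass_def by (subst W_finite_w) auto

lemma wr_le_mass: "finite S \<Longrightarrow> b \<in> S \<Longrightarrow> below b Q \<Longrightarrow> wr (lev b) \<le> mass S Q"
  unfolding mass_def using wr_pos
  by (intro member_le_sum[where f = "\<lambda>b. wr (lev b)"]) (auto simp: less_imp_le)

lemma wr_divide_Ints: "j \<le> m \<Longrightarrow> wr j / wr m \<in> \<int>"
proof -
  assume "j \<le> m"
  then have "wr j / wr m = real N ^ (m - j)"
    using N_pos by (simp add: wr_def power_diff)
  then show ?thesis by simp
qed

text \<open>The capacity is reduced at the single level \<open>l\<close>, where the density bound is
  wanted. It still dominates \<open>cut e l\<close>, so a cell filled to capacity pays for its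
  reduced weight.\<close>

definition cap :: "nat \<Rightarrow> nat \<Rightarrow> nat \<Rightarrow> real" where
  "cap e l j = (if j = l then wr (l + e) else wr j)"

lemma cut_le_cap: "cut e l j \<le> ennreal (cap e l j)"
  by (auto simp: cut_def cap_def intro!: ennreal_leI wr_antimono)

lemma cap_le_wr: "cap e l j \<le> wr j"
  by (auto simp: cap_def intro!: wr_antimono)

text \<open>Greedy selection by increasing level.  All weights and capacities involved are integer
  multiples of the weight of the current level, so a cell that cannot be selected lies in a cell
  whose capacity is used up exactly.\<close>

lemma greedy_step:
  assumes fin: "finite S" and S: "\<forall>b\<in>S. lev b < m"
    and adm: "\<forall>Q. below Q R \<longrightarrow> mass S Q \<le> cap e l (lev Q)"
    and F: "\<forall>b\<in>F. below b R \<and> l + e \<le> lev b"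
  shows "\<exists>T. finite T \<and> S \<subseteq> T \<and> T \<subseteq> S \<union> {b \<in> F. lev b = m} \<and>
    (\<forall>Q. below Q R \<longrightarrow> mass T Q \<le> cap e l (lev Q)) \<and>
    (\<forall>b\<in>F. lev b = m \<longrightarrow> b \<in> T \<or> (\<exists>Q. below Q R \<and> below b Q \<and> cap e l (lev Q) \<le> mass T Q))"
proof -
  define G where "G = {b \<in> F. lev b = m}"
  have "G \<subseteq> {b. below b R \<and> lev b < Suc m}" using F by (auto simp: G_def)
  then have finG: "finite G" using finite_below_less finite_subset by blast
  define A where "A = {T. S \<subseteq> T \<and> T \<subseteq> S \<union> G \<and> (\<forall>Q. below Q R \<longrightarrow> mass T Q \<le> cap e l (lev Q))}"
  have "A \<subseteq> Pow (S \<union> G)" by (auto simp: A_def)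
  then have "finite A" using fin finG finite_subset by blast
  moreover have "S \<in> A" using adm by (auto simp: A_def)
  ultimately obtain T where T: "T \<in> A" "\<And>T'. T' \<in> A \<Longrightarrow> T \<subseteq> T' \<Longrightarrow> T = T'"
    using finite_has_maximal2[of A S] by metis
  have finT: "finite T" using T(1) fin finG finite_subset by (auto simp: A_def)
  have "\<exists>Q. below Q R \<and> below b Q \<and> cap e l (lev Q) \<le> mass T Q" if b: "b \<in> G" "b \<notin> T" for b
  proof -
    have "insert b T \<notin> A" using T(2)[of "insert b T"] b by auto
    then obtain Q where Q: "below Q R" "cap e l (lev Q) < mass (insert b T) Q"
      using T(1) b by (auto simp: A_def not_le)
    have bQ: "below b Q"
    proof (rule ccontr)
      assume "\<not> below b Q"
      then have "{a. a \<in> insert b T \<and> below a Q} = {a. a \<in> T \<and> below a Q}" by auto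
      then have "mass (insert b T) Q = mass T Q" by (simp add: mass_def)
      then show False using Q T(1) by (auto simp: A_def not_le[symmetric])
    qed
    \<comment> \<open>By \<open>l + e \<le> m\<close> even the reduced capacity
      \<open>wr (l + e)\<close> is a multiple of \<open>wr m\<close>.\<close>
    have m: "lev b = m" "l + e \<le> m" using b F by (auto simp: G_def)
    have "{a. a \<in> insert b T \<and> below a Q} = insert b {a. a \<in> T \<and> below a Q}" using bQ by auto
    then have "mass (insert b T) Q = wr m + mass T Q"
      using b(2) finT m(1) by (simp add: mass_def)
    then have "(cap e l (lev Q) - mass T Q) / wr m < 1" using Q(2) wr_pos[of m] by simp
    moreover have "(cap e l (lev Q) - mass T Q) / wr m \<in> \<int>"
    proof -
      have "lev Q \<le> m" using bQ m by (auto simp: below_def)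
      then have "cap e l (lev Q) / wr m \<in> \<int>" using m by (auto simp: cap_def intro!: wr_divide_Ints)
      moreover have "lev a \<le> m" if "a \<in> T" for a
        using that T(1) S unfolding A_def G_def by (blast intro: less_imp_le eq_imp_le)
      then have "(\<Sum>a | a \<in> T \<and> below a Q. wr (lev a) / wr m) \<in> \<int>"
        by (intro Ints_sum wr_divide_Ints) auto
      then have "mass T Q / wr m \<in> \<int>" by (simp add: mass_def sum_divide_distrib)
      ultimately show ?thesis by (simp add: diff_divide_distrib)
    qed
    then obtain z where "(cap e l (lev Q) - mass T Q) / wr m = of_int z" by (elim Ints_cases)
    ultimately have "(cap e l (lev Q) - mass T Q) / wr m \<le> 0" by simp
    then have "cap e l (lev Q) \<le> mass T Q" using wr_pos[of m] by (simp add: divide_le_0_iff)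
    then show ?thesis using Q(1) bQ by auto
  qed
  then show ?thesis using T(1) finT unfolding A_def G_def by (intro exI[of _ T]) auto
qed

text \<open>Up to a small set, \<open>Z\<close> inside \<open>R\<close> is covered by selected cells
  and by cells filled to capacity. The maximal ones are disjoint and each contains selected weight
  at least its \<open>cut\<close> weight, so the selected weight is at least the reduced content. A
  finite stage then already exceeds \<open>B\<close>.\<close>

lemma greedy:
  assumes B: "B < content (cut e l) (Z \<inter> body R)" and p: "l + e \<le> p" "lev R \<le> p"
  obtains S where "finite S" "\<And>b. b \<in> S \<Longrightarrow> below b R \<and> p \<le> lev b \<and> full Z b" "B < W w S"
    "\<And>Q. below Q R \<Longrightarrow> mass S Q \<le> cap e l (lev Q)"
proof -
  define F where "F = {b. below b R \<and> p \<le> lev b \<and> full Z b}"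
  define I where "I = (\<lambda>m S. finite S \<and> S \<subseteq> F \<and> (\<forall>b\<in>S. lev b < m) \<and>
    (\<forall>Q. below Q R \<longrightarrow> mass S Q \<le> cap e l (lev Q)))"
  define J where "J = (\<lambda>m S T. S \<subseteq> T \<and> (\<forall>b\<in>F. lev b = m \<longrightarrow>
    b \<in> T \<or> (\<exists>Q. below Q R \<and> below b Q \<and> cap e l (lev Q) \<le> mass T Q)))"
  have "\<exists>S. \<forall>m::nat. I m (S m) \<and> J m (S m) (S (Suc m))"
  proof (rule dependent_nat_choice)
    have "0 \<le> cap e l j" for j using wr_pos by (simp add: cap_def less_imp_le)
    then have "I 0 {}" by (simp add: I_def mass_def)
    then show "\<exists>S. I 0 S" ..
    fix S m assume "I m S"
    then have S: "finite S" "S \<subseteq> F" "\<forall>b\<in>S. lev b < m"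
      "\<forall>Q. below Q R \<longrightarrow> mass S Q \<le> cap e l (lev Q)" by (auto simp: I_def)
    have F: "\<forall>b\<in>F. below b R \<and> l + e \<le> lev b" using p by (auto simp: F_def)
    obtain T where T: "finite T" "S \<subseteq> T" "T \<subseteq> S \<union> {b \<in> F. lev b = m}"
      "\<forall>Q. below Q R \<longrightarrow> mass T Q \<le> cap e l (lev Q)"
      "\<forall>b\<in>F. lev b = m \<longrightarrow> b \<in> T \<or> (\<exists>Q. below Q R \<and> below b Q \<and> cap e l (lev Q) \<le> mass T Q)"
      using greedy_step[OF S(1) S(3) S(4) F] by (elim exE conjE)
    have "I (Suc m) T" using T S(2,3) unfolding I_def by (auto simp: less_Suc_eq)
    moreover have "J m S T" using T by (simp add: J_def)
    ultimately show "\<exists>T. I (Suc m) T \<and> J m S T" by blast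
  qed
  then obtain S where SI: "\<And>m. I m (S m)" and SJ: "\<And>m. J m (S m) (S (Suc m))" by blast
  have inc: "incseq S" using SJ by (intro incseq_SucI) (simp add: J_def)
  define U where "U = (\<Union>m. S m)"
  \<comment> \<open>Contains the selected cells, because \<open>cut e l\<close> is at most
    \<open>w\<close>, and the cells filled to capacity, because \<open>cut e l\<close> is at most
    \<open>cap e l\<close>.\<close>
  define \<C> where "\<C> = {Q. below Q R \<and> cut e l (lev Q) \<le> W w {b \<in> U. below b Q}}"
  have "Z \<inter> body R - region \<C> \<subseteq> Z - region {b. p \<le> lev b \<and> full Z b}"
  proof (rule subsetI, rule ccontr)
    fix x assume x: "x \<in> Z \<inter> body R - region \<C>" and "x \<notin> Z - region {b. p \<le> lev b \<and> full Z b}"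
    then obtain b where b: "x \<in> body b" "p \<le> lev b" "full Z b" by (auto simp: region_def)
    then have "b \<in> F" using below_if_meets[of R b x] x p by (auto simp: F_def)
    then have "b \<in> S (Suc (lev b)) \<or>
        (\<exists>Q. below Q R \<and> below b Q \<and> cap e l (lev Q) \<le> mass (S (Suc (lev b))) Q)"
      using SJ[of "lev b"] unfolding J_def by blast
    then consider "b \<in> S (Suc (lev b))"
      | Q where "below Q R" "below b Q" "cap e l (lev Q) \<le> mass (S (Suc (lev b))) Q"
      by blast
    then have "\<exists>Q\<in>\<C>. x \<in> body Q"
    proof cases
      case 1
      then have "w (lev b) \<le> W w {a \<in> U. below a b}" by (intro W_ge_member) (auto simp: U_def)
      then have "cut e l (lev b) \<le> W w {a \<in> U. below a b}" using cut_le_w order_trans by blast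
      then have "b \<in> \<C>" using \<open>b \<in> F\<close> by (simp add: \<C>_def F_def)
      then show ?thesis using b by blast
    next
      case 2
      have fin: "finite (S (Suc (lev b)))" using SI by (auto simp: I_def)
      have "cut e l (lev Q) \<le> ennreal (mass (S (Suc (lev b))) Q)"
        using cut_le_cap ennreal_leI[OF 2(3)] by (rule order_trans)
      also have "\<dots> = W w {a \<in> S (Suc (lev b)). below a Q}" by (rule W_w_below[OF fin, symmetric])
      also have "\<dots> \<le> W w {a \<in> U. below a Q}" by (intro W_mono) (auto simp: U_def)
      finally have "Q \<in> \<C>" using 2(1) by (simp add: \<C>_def)
      then show ?thesis using b 2(2) below_body by blast
    qed
    then show False using x by (auto simp: region_def)
  qed
  then have "cov (Z \<inter> body R) (maxs \<C>)"
    unfolding cov_def region_maxs using small_off_full small_subset by blast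
  then have "content (cut e l) (Z \<inter> body R) \<le> W (cut e l) (maxs \<C>)" by (rule content_le)
  also have "\<dots> \<le> W w U"
  proof (rule W_le_truncations)
    fix m
    define H where "H = {b \<in> maxs \<C>. lev b < m}"
    have H: "H \<subseteq> maxs \<C>" by (auto simp: H_def)
    have "H \<subseteq> {b. below b R \<and> lev b < m}" using maxs_subset by (auto simp: H_def \<C>_def)
    then have finH: "finite H" using finite_below_less finite_subset by blast
    have "W (cut e l) H \<le> (\<Sum>Q\<in>H. W w {b \<in> U. below b Q})"
      using H maxs_subset by (subst W_finite[OF finH]) (intro sum_mono, auto simp: \<C>_def)
    also have "\<dots> = W w (\<Union>Q\<in>H. {b \<in> U. below b Q})"
      by (rule W_UN_disjoint[OF finH disjoint_below_maxs[OF H]])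
    also have "\<dots> \<le> W w U" by (rule W_mono) auto
    finally show "W (cut e l) {b \<in> maxs \<C>. lev b < m} \<le> W w U" by (simp add: H_def)
  qed
  also have "W w U = (SUP m. W w (S m))" unfolding U_def by (rule W_incseq[OF inc])
  finally have "B < (SUP m. W w (S m))" using B by (rule less_le_trans[rotated])
  then obtain m where "B < W w (S m)" by (auto simp: less_SUP_iff)
  moreover have "finite (S m)" "S m \<subseteq> F" "\<And>Q. below Q R \<Longrightarrow> mass (S m) Q \<le> cap e l (lev Q)"
    using SI[of m] by (auto simp: I_def)
  ultimately show thesis by (intro that[of "S m"]) (auto simp: F_def)
qed

text \<open>Since \<open>S\<close> is finite, one \<open>l\<close> serves all its cells, and
  \<open>greedy\<close> is applied in each separately. A cell \<open>Q\<close> inside a member of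
  \<open>S\<close> obeys the capacities; for any other \<open>Q\<close> the weight does not grow,
  because each member of \<open>S\<close> is replaced by at most its own weight.\<close>

lemma construction_step:
  assumes X: "incseq X" and finS: "finite S" and full: "\<forall>R\<in>S. full (\<Union>l. X l) R"
    and S: "\<forall>Q. mass S Q \<le> wr (lev Q)" and \<theta>: "0 \<le> \<theta>" "\<theta> < 1"
  shows "\<exists>l T. L < l \<and> finite T \<and> (\<forall>b\<in>T. l < lev b \<and> full (X l) b \<and> (\<exists>R\<in>S. below b R)) \<and>
    (\<forall>Q. mass T Q \<le> wr (lev Q)) \<and>
    (\<forall>Q. (\<forall>R\<in>S. lev Q \<le> lev R) \<longrightarrow> mass T Q \<le> mass S Q) \<and>
    (\<forall>Q. lev Q = l \<longrightarrow> mass T Q \<le> wr (l + e)) \<and>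
    \<theta> * (\<Sum>R\<in>S. wr (lev R)) \<le> (\<Sum>b\<in>T. wr (lev b))"
proof -
  \<comment> \<open>Members of \<open>S\<close> are disjoint: if one lay strictly inside another,
    the mass in the larger would exceed its weight.\<close>
  have uniq: "R1 = R2" if R: "R1 \<in> S" "R2 \<in> S" "below b R1" "below b R2" for b R1 R2
  proof -
    have *: "R1 = R2" if R: "R1 \<in> S" "R2 \<in> S" "below R1 R2" for R1 R2
    proof (rule ccontr)
      assume "R1 \<noteq> R2"
      then have "wr (lev R1) + wr (lev R2) = (\<Sum>b\<in>{R1, R2}. wr (lev b))" by simp
      also have "\<dots> \<le> mass S R2"
        unfolding mass_def using R finS wr_pos by (intro sum_mono2) (auto simp: less_imp_le)
      also have "\<dots> \<le> wr (lev R2)" using S by blast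
      finally show False using wr_pos[of "lev R1"] by simp
    qed
    show ?thesis using below_common[OF R(3,4)] below_common[OF R(4,3)] *[of R1 R2] *[of R2 R1] R(1,2)
      by (metis nat_le_linear)
  qed
  have ev: "\<forall>\<^sub>F l in sequentially. \<forall>R\<in>S. ennreal (\<theta> * wr (lev R)) < content (cut e l) (X l \<inter> body R)"
  proof (intro eventually_ball_finite[OF finS] ballI)
    fix R assume "R \<in> S"
    then have "full (\<Union>l. X l) R" using full by blast
    moreover have "ennreal (\<theta> * wr (lev R)) < w (lev R)"
      using \<theta> wr_pos[of "lev R"] by (intro ennreal_lessI) auto
    ultimately show "\<forall>\<^sub>F l in sequentially. ennreal (\<theta> * wr (lev R)) < content (cut e l) (X l \<inter> body R)"
      by (rule eventually_content_cut[OF X])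
  qed
  \<comment> \<open>Beyond all levels in \<open>S\<close>, so that a cell of level \<open>l\<close>
    lies in a member of \<open>S\<close> or is disjoint from all of them.\<close>
  define M where "M = Suc (L + Max (insert 0 (lev ` S)))"
  have "\<forall>\<^sub>F l in sequentially. M \<le> l" by (rule eventually_ge_at_top)
  with ev have "\<forall>\<^sub>F l in sequentially. (\<forall>R\<in>S. ennreal (\<theta> * wr (lev R)) < content (cut e l) (X l \<inter> body R)) \<and> M \<le> l"
    by (rule eventually_conj)
  then obtain l where l: "\<And>R. R \<in> S \<Longrightarrow> ennreal (\<theta> * wr (lev R)) < content (cut e l) (X l \<inter> body R)" "M \<le> l"
    using eventually_happens'[OF sequentially_bot] by blast
  have lev: "lev R < l" if "R \<in> S" for R
  proof -
    have "lev R \<le> Max (insert 0 (lev ` S))" using that finS by (intro Max_ge) auto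
    then show ?thesis using l(2) by (simp add: M_def)
  qed
  \<comment> \<open>Starting at level \<open>Suc (l + e)\<close> meets the level requirement of
    \<open>greedy\<close> and also makes every new cell strictly finer than level
    \<open>l\<close>.\<close>
  have "\<exists>T. finite T \<and> (\<forall>b\<in>T. below b R \<and> Suc (l + e) \<le> lev b \<and> full (X l) b) \<and>
      ennreal (\<theta> * wr (lev R)) < W w T \<and> (\<forall>Q. below Q R \<longrightarrow> mass T Q \<le> cap e l (lev Q))" if "R \<in> S" for R
    using greedy[OF l(1)[OF that], of "Suc (l + e)"] lev[OF that] by (metis le_SucI less_imp_le order_refl trans_le_add1)
  then obtain T where T: "\<And>R. R \<in> S \<Longrightarrow> finite (T R)"
    "\<And>R b. R \<in> S \<Longrightarrow> b \<in> T R \<Longrightarrow> below b R \<and> Suc (l + e) \<le> lev b \<and> full (X l) b"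
    "\<And>R. R \<in> S \<Longrightarrow> ennreal (\<theta> * wr (lev R)) < W w (T R)"
    "\<And>R Q. R \<in> S \<Longrightarrow> below Q R \<Longrightarrow> mass (T R) Q \<le> cap e l (lev Q)"
    by metis
  define U where "U = (\<Union>R\<in>S. T R)"
  have finU: "finite U" using finS T(1) by (auto simp: U_def)
  have in_one: "mass U Q \<le> cap e l (lev Q)" if "R \<in> S" "below Q R" for Q R
  proof -
    have "b \<in> T R" if b: "b \<in> U" "below b Q" for b
    proof -
      obtain R' where R': "R' \<in> S" "b \<in> T R'" using b by (auto simp: U_def)
      then have "R' = R" using uniq[of R' R b] T(2) that(1) below_trans[OF b(2)] \<open>R \<in> S\<close> \<open>below Q R\<close> by blast
      then show ?thesis using R' by simp
    qed
    then have "{b. b \<in> U \<and> below b Q} = {b. b \<in> T R \<and> below b Q}" using that(1) by (auto simp: U_def)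
    then show ?thesis using T(4)[OF that] by (simp add: mass_def)
  qed
  have totalR: "(\<Sum>b\<in>T R. wr (lev b)) \<le> wr (lev R)" if "R \<in> S" for R
  proof -
    have "{b. b \<in> T R \<and> below b R} = T R" using T(2)[OF that] by auto
    then show ?thesis using T(4)[OF that below_refl] cap_le_wr[of e l "lev R"] by (simp add: mass_def)
  qed
  have disj: "T R1 \<inter> T R2 = {}" if "R1 \<in> S" "R2 \<in> S" "R1 \<noteq> R2" for R1 R2
    using that uniq T(2) by blast
  have above: "mass U Q \<le> mass S Q" if Q: "\<And>R. R \<in> S \<Longrightarrow> \<not> below Q R" for Q
  proof -
    have "{b. b \<in> U \<and> below b Q} \<subseteq> (\<Union>R\<in>{R. R \<in> S \<and> below R Q}. T R)"
    proof
      fix b assume b: "b \<in> {b. b \<in> U \<and> below b Q}"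
      then obtain R where R: "R \<in> S" "b \<in> T R" by (auto simp: U_def)
      then have "below b R" "below b Q" using T(2) b by auto
      then have "below R Q" using Q[OF R(1)] below_common nat_le_linear by blast
      then show "b \<in> (\<Union>R\<in>{R. R \<in> S \<and> below R Q}. T R)" using R by blast
    qed
    then have "mass U Q \<le> (\<Sum>b\<in>(\<Union>R\<in>{R. R \<in> S \<and> below R Q}. T R). wr (lev b))"
      unfolding mass_def using finS T(1) wr_pos by (intro sum_mono2) (auto simp: less_imp_le)
    also have "\<dots> = (\<Sum>R\<in>{R. R \<in> S \<and> below R Q}. \<Sum>b\<in>T R. wr (lev b))"
      using finS T(1) disj by (intro sum.UNION_disjoint) auto
    also have "\<dots> \<le> (\<Sum>R\<in>{R. R \<in> S \<and> below R Q}. wr (lev R))"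
      using totalR by (intro sum_mono) auto
    finally show ?thesis by (simp add: mass_def)
  qed
  have "mass U Q \<le> wr (lev Q)" for Q
  proof (cases "\<exists>R\<in>S. below Q R")
    case True
    then show ?thesis using in_one cap_le_wr order_trans by blast
  next
    case False
    then have "mass U Q \<le> mass S Q" using above by blast
    then show ?thesis using S order_trans by blast
  qed
  moreover have "mass U Q \<le> mass S Q" if Q: "\<forall>R\<in>S. lev Q \<le> lev R" for Q
  proof (cases "\<exists>R\<in>S. below Q R")
    case True
    then obtain R where R: "R \<in> S" "below Q R" by blast
    then have "Q = R" using Q below_antisym by blast
    then have "mass U Q \<le> wr (lev R)" "wr (lev R) \<le> mass S Q"
      using in_one[OF R] cap_le_wr[of e l "lev R"] wr_le_mass[OF finS R(1)] by auto
    then show ?thesis by simp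
  next
    case False
    then show ?thesis using above by blast
  qed
  moreover have "mass U Q \<le> wr (l + e)" if Q: "lev Q = l" for Q
  proof (cases "\<exists>R\<in>S. below Q R")
    case True
    then show ?thesis using in_one Q by (fastforce simp: cap_def)
  next
    case False
    have "{b. b \<in> U \<and> below b Q} = {}"
    proof (rule equals0I)
      fix b assume b: "b \<in> {b. b \<in> U \<and> below b Q}"
      then obtain R where R: "R \<in> S" "b \<in> T R" by (auto simp: U_def)
      then have "below b R" "below b Q" using T(2) b by auto
      then have "below Q R" using below_common lev[OF R(1)] Q less_imp_le by blast
      then show False using False R(1) by blast
    qed
    then have "mass U Q = 0" unfolding mass_def by (metis sum.empty)
    then show ?thesis using wr_pos[of "l + e"] by simp
  qed
  moreover have "\<theta> * (\<Sum>R\<in>S. wr (lev R)) \<le> (\<Sum>b\<in>U. wr (lev b))"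
  proof -
    have "\<theta> * wr (lev R) \<le> (\<Sum>b\<in>T R. wr (lev b))" if "R \<in> S" for R
    proof -
      have "ennreal (\<theta> * wr (lev R)) < ennreal (\<Sum>b\<in>T R. wr (lev b))"
        using T(3)[OF that] W_finite_w[OF T(1)[OF that]] by simp
      then show ?thesis
        by (meson ennreal_leI leD leI nle_le)
    qed
    then have "\<theta> * (\<Sum>R\<in>S. wr (lev R)) \<le> (\<Sum>R\<in>S. \<Sum>b\<in>T R. wr (lev b))"
      by (simp add: sum_distrib_left sum_mono)
    also have "\<dots> = (\<Sum>b\<in>U. wr (lev b))"
      unfolding U_def using finS T(1) disj by (intro sum.UNION_disjoint[symmetric]) auto
    finally show ?thesis .
  qed
  moreover have "l < lev b \<and> full (X l) b \<and> (\<exists>R\<in>S. below b R)" if "b \<in> U" for b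
    using that T(2) by (fastforce simp: U_def)
  moreover have "L < l" using l(2) by (simp add: M_def)
  ultimately show ?thesis using finU by (intro exI[of _ l] exI[of _ U]) blast
qed

section \<open>Iteration of the construction step\<close>

lemma full_nonempty: "full X b \<Longrightarrow> X \<inter> body b \<noteq> {}"
  using content_empty[of w] wr_pos[of "lev b"] by (auto simp: full_def)

text \<open>\<open>P\<close> abstracts the increasing unions behind a Souslin set: stage
  \<open>i\<close> replaces \<open>P ns\<close> by one term \<open>P (ns @ [l])\<close> of the
  sequence exhausting it. The reduction exponent is \<open>e = i\<close>, whence the bound
  \<open>wr (l i + i)\<close>.\<close>

theorem net_construction:
  fixes P :: "nat list \<Rightarrow> 'a set"
  assumes P_UN: "\<And>ns. P ns = (\<Union>l. P (ns @ [l]))" and P_inc: "\<And>ns. incseq (\<lambda>l. P (ns @ [l]))"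
    and "\<not> small (P [])"
  obtains S :: "nat \<Rightarrow> 'c set" and l :: "nat \<Rightarrow> nat" and c :: real where
    "\<And>i. finite (S i)"
    "\<And>i b. b \<in> S (Suc i) \<Longrightarrow> \<exists>a\<in>S i. below b a"
    "\<And>i b. b \<in> S i \<Longrightarrow> P (map l [0..<i]) \<inter> body b \<noteq> {}"
    "\<And>i b. b \<in> S i \<Longrightarrow> i \<le> lev b"
    "\<And>i Q. mass (S i) Q \<le> wr (lev Q)"
    "0 < c" "\<And>i. c \<le> (\<Sum>b\<in>S i. wr (lev b))"
    "\<And>i j b. i < j \<Longrightarrow> b \<in> S j \<Longrightarrow> l i < lev b"
    "\<And>i j Q. i < j \<Longrightarrow> lev Q = l i \<Longrightarrow> mass (S j) Q \<le> wr (l i + i)"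
proof -
  have "\<exists>R. full (P []) R"
  proof (rule ccontr)
    assume "\<not> (\<exists>R. full (P []) R)"
    then have "P [] - region {b. 0 \<le> lev b \<and> full (P []) b} = P []" by (auto simp: region_def)
    then show False using small_off_full[of "P []" 0] assms(3) by simp
  qed
  then obtain R0 where R0: "full (P []) R0" ..
  \<comment> \<open>Strictly decreasing with limit half the initial weight: each stage may lose a
    factor \<open>\<theta> < 1\<close> while the total stays bounded below.\<close>
  define a where "a = (\<lambda>i. (1 + (1/2) ^ i) / 2 * wr (lev R0))"
  define I where "I = (\<lambda>i (ns, S). length ns = i \<and> finite S \<and> (\<forall>b\<in>S. full (P ns) b \<and> i \<le> lev b) \<and>
    (\<forall>Q. mass S Q \<le> wr (lev Q)) \<and> a i \<le> (\<Sum>b\<in>S. wr (lev b)))"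
  define J where "J = (\<lambda>i (ns, S) (ns', T). \<exists>l. ns' = ns @ [l] \<and> i < l \<and>
    (\<forall>b\<in>T. l < lev b \<and> (\<exists>R\<in>S. below b R)) \<and>
    (\<forall>Q. (\<forall>R\<in>S. lev Q \<le> lev R) \<longrightarrow> mass T Q \<le> mass S Q) \<and>
    (\<forall>Q. lev Q = l \<longrightarrow> mass T Q \<le> wr (l + i)))"
  have "\<exists>f. \<forall>i. I i (f i) \<and> J i (f i) (f (Suc i))"
  proof (rule dependent_nat_choice)
    have "mass {R0} Q \<le> wr (lev Q)" for Q
    proof (cases "below R0 Q")
      case True
      then have "{b. b \<in> {R0} \<and> below b Q} = {R0}" by auto
      then have "mass {R0} Q = wr (lev R0)" by (simp add: mass_def)
      then show ?thesis using True by (auto simp: below_def intro: wr_antimono)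
    next
      case False
      then have "{b. b \<in> {R0} \<and> below b Q} = {}" by auto
      then have "mass {R0} Q = 0" unfolding mass_def by (metis sum.empty)
      then show ?thesis using wr_pos[of "lev Q"] by simp
    qed
    then have "I 0 ([], {R0})" using R0 by (simp add: I_def a_def)
    then show "\<exists>x. I 0 x" ..
  next
    fix x i assume "I i x"
    obtain ns S where x: "x = (ns, S)" by fastforce
    then have S: "length ns = i" "finite S" "\<forall>b\<in>S. full (\<Union>l. P (ns @ [l])) b" "\<forall>b\<in>S. i \<le> lev b"
      "\<forall>Q. mass S Q \<le> wr (lev Q)" "a i \<le> (\<Sum>b\<in>S. wr (lev b))"
      using \<open>I i x\<close> P_UN[of ns] by (auto simp: I_def)
    define \<theta> where "\<theta> = a (Suc i) / a i"
    have a: "0 < a (Suc i)" "a (Suc i) < a i" "0 < a i"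
      using wr_pos[of "lev R0"] by (auto simp: a_def add_pos_pos)
    then have \<theta>: "0 \<le> \<theta>" "\<theta> < 1" by (auto simp: \<theta>_def)
    from construction_step[OF P_inc S(2,3,5) \<theta>, of i i]
    obtain l T where T: "i < l" "finite T" "\<forall>b\<in>T. l < lev b \<and> full (P (ns @ [l])) b \<and> (\<exists>R\<in>S. below b R)"
      "\<forall>Q. mass T Q \<le> wr (lev Q)"
      "\<forall>Q. (\<forall>R\<in>S. lev Q \<le> lev R) \<longrightarrow> mass T Q \<le> mass S Q"
      "\<forall>Q. lev Q = l \<longrightarrow> mass T Q \<le> wr (l + i)"
      "\<theta> * (\<Sum>R\<in>S. wr (lev R)) \<le> (\<Sum>b\<in>T. wr (lev b))" by blast
    have "a (Suc i) = \<theta> * a i" using a by (simp add: \<theta>_def)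
    also have "\<dots> \<le> \<theta> * (\<Sum>R\<in>S. wr (lev R))" using S(6) \<theta> by (intro mult_left_mono)
    finally have "a (Suc i) \<le> (\<Sum>b\<in>T. wr (lev b))" using T(7) by simp
    then have "I (Suc i) (ns @ [l], T)" using S(1) T(1-4) by (auto simp: I_def)
    moreover have "J i x (ns @ [l], T)" using T(1,3,5,6) unfolding J_def x by auto
    ultimately show "\<exists>y. I (Suc i) y \<and> J i x y" by blast
  qed
  then obtain f where fI: "\<And>i. I i (f i)" and fJ: "\<And>i. J i (f i) (f (Suc i))" by blast
  define S where "S = (\<lambda>i. snd (f i))"
  define ns where "ns = (\<lambda>i. fst (f i))"
  define l where "l = (\<lambda>i. last (ns (Suc i)))"
  have I: "length (ns i) = i" "finite (S i)" "\<And>b. b \<in> S i \<Longrightarrow> full (P (ns i)) b \<and> i \<le> lev b"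
    "\<And>Q. mass (S i) Q \<le> wr (lev Q)" "a i \<le> (\<Sum>b\<in>S i. wr (lev b))" for i
    using fI[of i] by (auto simp: I_def S_def ns_def split_beta)
  have J: "ns (Suc i) = ns i @ [l i]" "i < l i"
    "\<And>b. b \<in> S (Suc i) \<Longrightarrow> l i < lev b \<and> (\<exists>R\<in>S i. below b R)"
    "\<And>Q. (\<And>R. R \<in> S i \<Longrightarrow> lev Q \<le> lev R) \<Longrightarrow> mass (S (Suc i)) Q \<le> mass (S i) Q"
    "\<And>Q. lev Q = l i \<Longrightarrow> mass (S (Suc i)) Q \<le> wr (l i + i)" for i
  proof -
    from fJ[of i] obtain m where m: "ns (Suc i) = ns i @ [m]" "i < m"
      "\<forall>b\<in>S (Suc i). m < lev b \<and> (\<exists>R\<in>S i. below b R)"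
      "\<forall>Q. (\<forall>R\<in>S i. lev Q \<le> lev R) \<longrightarrow> mass (S (Suc i)) Q \<le> mass (S i) Q"
      "\<forall>Q. lev Q = m \<longrightarrow> mass (S (Suc i)) Q \<le> wr (m + i)"
      by (auto simp: J_def S_def ns_def split_beta)
    moreover have "l i = m" using m(1) by (simp add: l_def)
    ultimately show "ns (Suc i) = ns i @ [l i]" "i < l i"
      "\<And>b. b \<in> S (Suc i) \<Longrightarrow> l i < lev b \<and> (\<exists>R\<in>S i. below b R)"
      "\<And>Q. (\<And>R. R \<in> S i \<Longrightarrow> lev Q \<le> lev R) \<Longrightarrow> mass (S (Suc i)) Q \<le> mass (S i) Q"
      "\<And>Q. lev Q = l i \<Longrightarrow> mass (S (Suc i)) Q \<le> wr (l i + i)" by auto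
  qed
  have ns: "ns i = map l [0..<i]" for i
  proof (induction i)
    case 0
    then show ?case using I(1)[of 0] by simp
  next
    case (Suc i)
    then show ?case using J(1) by simp
  qed
  have levS: "l i < lev b" if "i < j" "b \<in> S j" for i j b
    using that
  proof (induction j arbitrary: b)
    case (Suc j)
    show ?case
    proof (cases "i = j")
      case True
      then show ?thesis using J(3) Suc.prems by blast
    next
      case False
      then obtain R where "R \<in> S j" "below b R" "i < j" using J(3) Suc.prems by fastforce
      then show ?thesis using Suc.IH[of R] by (auto simp: below_def)
    qed
  qed simp
  \<comment> \<open>The bound is created at stage \<open>Suc i\<close>. From then on all cells are
    finer than level \<open>l i\<close>, and later stages do not increase the mass in such a coarse
    \<open>Q\<close>.\<close>
  have massS: "mass (S j) Q \<le> wr (l i + i)" if "i < j" "lev Q = l i" for i j Q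
    using that
  proof (induction j)
    case (Suc j)
    show ?case
    proof (cases "i = j")
      case True
      then show ?thesis using J(5) Suc.prems by blast
    next
      case False
      then have "i < j" using Suc.prems by simp
      then have "mass (S (Suc j)) Q \<le> mass (S j) Q"
        using levS[of i j] Suc.prems by (intro J(4)) (auto simp: less_imp_le)
      then show ?thesis using Suc \<open>i < j\<close> by auto
    qed
  qed simp
  show thesis
  proof (rule that[of S l "wr (lev R0) / 2"])
    show "wr (lev R0) / 2 \<le> (\<Sum>b\<in>S i. wr (lev b))" for i
    proof -
      have "wr (lev R0) / 2 \<le> a i" using wr_pos[of "lev R0"] by (simp add: a_def field_simps)
      then show ?thesis using I(5)[of i] by simp
    qed
    show "P (map l [0..<i]) \<inter> body b \<noteq> {}" if "b \<in> S i" for i b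
      using full_nonempty I(3)[OF that] by (simp add: ns[symmetric])
  qed (use I J(3) levS massS wr_pos in auto)
qed

end

section \<open>Hausdorff measure and dyadic cells\<close>

lemma hausdorff_premeasure_mono: "X \<subseteq> Y \<Longrightarrow> hausdorff_premeasure k \<delta> X \<le> hausdorff_premeasure k \<delta> Y"
  unfolding hausdorff_premeasure_def by (intro INF_superset_mono) auto

lemma hausdorff_measure_mono: "X \<subseteq> Y \<Longrightarrow> hausdorff_measure k X \<le> hausdorff_measure k Y"
  unfolding hausdorff_measure_def by (intro SUP_mono) (auto intro: hausdorff_premeasure_mono)

lemma hausdorff_sigma_finite_subset:
  assumes "hausdorff_sigma_finite k X" "Y \<subseteq> X"
  shows "hausdorff_sigma_finite k Y"
proof -
  obtain A where A: "X = (\<Union>i::nat. A i)" "\<And>i. hausdorff_measure k (A i) < \<infinity>"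
    using assms(1) unfolding hausdorff_sigma_finite_def by blast
  have "hausdorff_measure k (A i \<inter> Y) < \<infinity>" for i
    using hausdorff_measure_mono[of "A i \<inter> Y" "A i" k] A(2)[of i] by (simp add: le_less_trans)
  moreover have "Y = (\<Union>i. A i \<inter> Y)" using A(1) assms(2) by auto
  ultimately show ?thesis unfolding hausdorff_sigma_finite_def by (intro exI[of _ "\<lambda>i. A i \<inter> Y"]) simp
qed

lemma hausdorff_sigma_finite_UN:
  assumes "\<And>n::nat. hausdorff_sigma_finite k (Z n)"
  shows "hausdorff_sigma_finite k (\<Union>n. Z n)"
proof -
  have "\<forall>n. \<exists>A. Z n = (\<Union>i::nat. A i) \<and> (\<forall>i. hausdorff_measure k (A i) < \<infinity>)"
    using assms unfolding hausdorff_sigma_finite_def by blast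
  then obtain A where A: "\<And>n. Z n = (\<Union>i::nat. A n i)" "\<And>n i. hausdorff_measure k (A n i) < \<infinity>"
    by metis
  define A' where "A' = (\<lambda>m. case prod_decode m of (n, i) \<Rightarrow> A n i)"
  have "(\<Union>n. Z n) = (\<Union>m. A' m)"
  proof
    show "(\<Union>n. Z n) \<subseteq> (\<Union>m. A' m)"
    proof
      fix x assume "x \<in> (\<Union>n. Z n)"
      then obtain n i where "x \<in> A n i" using A(1) by auto
      then have "x \<in> A' (prod_encode (n, i))" by (simp add: A'_def)
      then show "x \<in> (\<Union>m. A' m)" by blast
    qed
    show "(\<Union>m. A' m) \<subseteq> (\<Union>n. Z n)" using A(1) by (auto simp: A'_def split: prod.splits)
  qed
  moreover have "hausdorff_measure k (A' m) < \<infinity>" for m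
    using A(2) by (simp add: A'_def split: prod.splits)
  ultimately show ?thesis unfolding hausdorff_sigma_finite_def by blast
qed

lemma hausdorff_premeasure_le_cover:
  fixes G :: "'c::countable \<Rightarrow> 'a::metric_space set"
  assumes "X \<subseteq> \<Union>(G ` \<C>)" "\<And>b. b \<in> \<C> \<Longrightarrow> bounded (G b) \<and> diameter (G b) \<le> \<delta>" "0 \<le> \<delta>"
    and f: "\<And>b. b \<in> \<C> \<Longrightarrow> hausdorff_weight k (G b) \<le> f b"
  shows "hausdorff_premeasure k \<delta> X \<le> emeasure (point_measure UNIV f) \<C>"
proof -
  define C where "C = (\<lambda>i. if i \<in> to_nat ` \<C> then G (from_nat i) else {})"
  have C: "C (to_nat b) = (if b \<in> \<C> then G b else {})" for b
    by (auto simp: C_def)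
  have "X \<subseteq> (\<Union>i. C i)"
  proof
    fix x assume "x \<in> X"
    then obtain b where "b \<in> \<C>" "x \<in> G b" using assms(1) by auto
    then have "x \<in> C (to_nat b)" by (simp add: C)
    then show "x \<in> (\<Union>i. C i)" by blast
  qed
  moreover have "bounded (C i) \<and> diameter (C i) \<le> \<delta>" for i
    using assms(2,3) by (auto simp: C_def)
  ultimately have "hausdorff_premeasure k \<delta> X \<le> (\<Sum>i. hausdorff_weight k (C i))"
    unfolding hausdorff_premeasure_def by (intro INF_lower) auto
  also have "\<dots> = (\<integral>\<^sup>+i. hausdorff_weight k (C i) \<partial>count_space UNIV)"
    by (rule nn_integral_count_space_nat[symmetric])
  also have "\<dots> = (\<integral>\<^sup>+i. hausdorff_weight k (C i) \<partial>count_space (range (to_nat :: 'c \<Rightarrow> nat)))"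
    by (intro nn_integral_count_space_eq) (auto simp: C_def hausdorff_weight_def)
  also have "\<dots> = (\<integral>\<^sup>+b. hausdorff_weight k (C (to_nat (b :: 'c))) \<partial>count_space UNIV)"
    by (intro nn_integral_bij_count_space[symmetric] inj_on_imp_bij_betw) simp
  also have "\<dots> \<le> (\<integral>\<^sup>+b. f b * indicator \<C> b \<partial>count_space UNIV)"
    by (intro nn_integral_mono) (auto simp: C f, simp add: hausdorff_weight_def)
  also have "\<dots> = emeasure (point_measure UNIV f) \<C>"
    unfolding point_measure_def by (subst emeasure_density) auto
  finally show ?thesis .
qed

lemma hausdorff_weight_le:
  assumes "bounded C" "diameter C \<le> d"
  shows "hausdorff_weight k C \<le> ennreal (unit_ball_vol (real k) * (d / 2) ^ k)"
proof -
  have "(diameter C / 2) ^ k \<le> (d / 2) ^ k"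
    using assms diameter_ge_0 by (intro power_mono) auto
  then show ?thesis
    by (auto simp: hausdorff_weight_def intro!: ennreal_leI mult_left_mono unit_ball_vol_nonneg)
qed

section \<open>Half-open dyadic cubes as a net\<close>

lemma finite_int_vec_box: "finite {z :: int ^ 'n. \<forall>i. \<bar>z $ i\<bar> \<le> m}"
proof -
  have "inj_on vec_nth {z :: int ^ 'n. \<forall>i. \<bar>z $ i\<bar> \<le> m}" by (auto simp: inj_on_def vec_eq_iff)
  moreover have "vec_nth ` {z :: int ^ 'n. \<forall>i. \<bar>z $ i\<bar> \<le> m} \<subseteq> PiE UNIV (\<lambda>_. {- m..m})"
    by (auto simp: abs_le_iff) (metis minus_le_iff)
  moreover have "finite (PiE (UNIV :: 'n set) (\<lambda>_. {- m..m}))" by (intro finite_PiE) auto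
  ultimately show ?thesis using finite_subset finite_imageD by blast
qed

text \<open>Dyadic cubes of side \<open>2 ^ - fst b\<close> described by rounding, hence half-open:
  the cubes of one level partition the space.\<close>

definition cell :: "nat \<times> (int ^ 'n) \<Rightarrow> (real ^ 'n) set" where
  "cell b = {x. \<forall>i. \<lfloor>2 ^ fst b * x $ i\<rfloor> = snd b $ i}"

definition floor_vec :: "nat \<Rightarrow> real ^ 'n \<Rightarrow> int ^ 'n" where
  "floor_vec j x = (\<chi> i. \<lfloor>2 ^ j * x $ i\<rfloor>)"

lemma in_cell_iff: "x \<in> cell b \<longleftrightarrow> snd b = floor_vec (fst b) x"
  by (auto simp: cell_def floor_vec_def vec_eq_iff)

lemma cell_nonempty: "cell b \<noteq> {}"
proof -
  have "(\<chi> i. real_of_int (snd b $ i) / 2 ^ fst b) \<in> cell b" by (simp add: cell_def)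
  then show ?thesis by blast
qed

text \<open>The coarse floor is the integer quotient of the fine floor by a power of two. This gives
  the nesting of cells.\<close>

lemma floor_vec_coarser:
  assumes "j \<le> j'" "floor_vec j' x = floor_vec j' y"
  shows "floor_vec j x = floor_vec j y"
proof -
  have *: "\<lfloor>2 ^ j * z\<rfloor> = \<lfloor>2 ^ j' * z\<rfloor> div 2 ^ (j' - j)" for z :: real
  proof -
    have "(2::real) ^ j' = 2 ^ j * 2 ^ (j' - j)"
      using assms(1) by (simp flip: power_add)
    then have "2 ^ j * z = (2 ^ j' * z) / real_of_int (2 ^ (j' - j))" by simp
    also have "\<lfloor>\<dots>\<rfloor> = \<lfloor>2 ^ j' * z\<rfloor> div 2 ^ (j' - j)"
      by (rule floor_divide_real_eq_div) simp
    finally show ?thesis .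
  qed
  show ?thesis using assms(2) unfolding floor_vec_def vec_eq_iff by (simp add: *)
qed

lemma cell_dist_le:
  assumes "x \<in> cell (b :: nat \<times> (int ^ 'n))" "y \<in> cell b"
  shows "dist x y \<le> real CARD('n) / 2 ^ fst b"
proof -
  have "\<bar>(x - y) $ i\<bar> \<le> 1 / 2 ^ fst b" for i
  proof -
    have "\<lfloor>2 ^ fst b * x $ i\<rfloor> = \<lfloor>2 ^ fst b * y $ i\<rfloor>" using assms by (simp add: cell_def)
    then have "\<bar>2 ^ fst b * x $ i - 2 ^ fst b * y $ i\<bar> \<le> 1" by linarith
    also have "2 ^ fst b * x $ i - 2 ^ fst b * y $ i = 2 ^ fst b * (x - y) $ i"
      by (simp add: algebra_simps)
    finally have "2 ^ fst b * \<bar>(x - y) $ i\<bar> \<le> 1" by (simp only: abs_mult) simp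
    then show ?thesis by (simp add: pos_le_divide_eq mult.commute)
  qed
  then have "norm (x - y) \<le> (\<Sum>i\<in>(UNIV :: 'n set). 1 / 2 ^ fst b)"
    by (intro order_trans[OF norm_le_l1_cart] sum_mono)
  then show ?thesis by (simp add: dist_norm)
qed

lemma bounded_cell: "bounded (cell b)"
  unfolding bounded_two_points using cell_dist_le by blast

lemma diameter_cell_le: "diameter (cell (b :: nat \<times> (int ^ 'n))) \<le> real CARD('n) / 2 ^ fst b"
  using cell_dist_le[of _ b] by (intro diameter_le) (simp_all flip: dist_norm)

lemma finite_cells_meeting:
  assumes "bounded (B :: (real ^ 'n) set)"
  shows "finite {b. fst b = j \<and> cell b \<inter> B \<noteq> {}}"
proof -
  obtain r where r: "\<And>x. x \<in> B \<Longrightarrow> norm x \<le> r" using assms bounded_iff by metis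
  define m where "m = \<lceil>2 ^ j * r\<rceil> + 1"
  have "{b. fst b = j \<and> cell b \<inter> B \<noteq> {}} \<subseteq> Pair j ` {z :: int ^ 'n. \<forall>i. \<bar>z $ i\<bar> \<le> m}"
  proof
    fix b :: "nat \<times> (int ^ 'n)" assume "b \<in> {b. fst b = j \<and> cell b \<inter> B \<noteq> {}}"
    then obtain x where x: "fst b = j" "x \<in> cell b" "x \<in> B" by auto
    have "\<bar>snd b $ i\<bar> \<le> m" for i
    proof -
      have "\<bar>x $ i\<bar> \<le> r" using component_le_norm_cart[of x i] r[OF x(3)] by linarith
      then have "\<bar>2 ^ j * x $ i\<bar> \<le> 2 ^ j * r" by (simp add: abs_mult)
      moreover have "snd b $ i = \<lfloor>2 ^ j * x $ i\<rfloor>" using x(1,2) by (simp add: cell_def)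
      ultimately show ?thesis unfolding m_def by linarith
    qed
    then show "b \<in> Pair j ` {z :: int ^ 'n. \<forall>i. \<bar>z $ i\<bar> \<le> m}" using x(1) by (cases b) auto
  qed
  then show ?thesis using finite_int_vec_box finite_surj by blast
qed

text \<open>The substance is \<open>small_if_covers\<close>: the Hausdorff weight of a cell is at
  most a constant times its net weight, so covers at all scales with bounded net weight give finite
  measure.\<close>

lemma net_cell:
  assumes "1 \<le> k"
  shows "net (cell :: nat \<times> (int ^ 'n) \<Rightarrow> _) fst (2 ^ k) (hausdorff_sigma_finite k)"
proof
  show "(0::nat) < 2 ^ k" by simp
  show "cell a \<noteq> {}" for a :: "nat \<times> (int ^ 'n)" by (rule cell_nonempty)
  show "cell b \<subseteq> cell a" if ab: "fst a \<le> fst b" "cell a \<inter> cell b \<noteq> {}" for a b :: "nat \<times> (int ^ 'n)"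
  proof
    fix y assume y: "y \<in> cell b"
    obtain x where "x \<in> cell a" "x \<in> cell b" using ab(2) by blast
    then show "y \<in> cell a" using y floor_vec_coarser[OF ab(1), of x y] by (simp add: in_cell_iff)
  qed
  show "a = b" if "fst a = fst b" "cell a \<inter> cell b \<noteq> {}" for a b :: "nat \<times> (int ^ 'n)"
    using that by (auto simp: in_cell_iff prod_eq_iff)
  show "\<exists>a. fst a = j \<and> x \<in> cell a" for j and x :: "real ^ 'n"
    by (intro exI[of _ "(j, floor_vec j x)"]) (simp add: in_cell_iff)
  show "finite {b. fst b = j \<and> cell b \<subseteq> cell a}" for j and a :: "nat \<times> (int ^ 'n)"
  proof (rule finite_subset)
    show "{b. fst b = j \<and> cell b \<subseteq> cell a} \<subseteq> {b. fst b = j \<and> cell b \<inter> cell a \<noteq> {}}"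
      using cell_nonempty by blast
  qed (rule finite_cells_meeting[OF bounded_cell])
  show "countable (UNIV :: (nat \<times> (int ^ 'n)) set)" by simp
  show "hausdorff_sigma_finite k Y" if "hausdorff_sigma_finite k X" "Y \<subseteq> X" for X Y :: "(real ^ 'n) set"
    using that by (rule hausdorff_sigma_finite_subset)
  show "hausdorff_sigma_finite k (\<Union>n. Z n)" if "\<And>n::nat. hausdorff_sigma_finite k (Z n)"
    for Z :: "nat \<Rightarrow> (real ^ 'n) set" using that by (rule hausdorff_sigma_finite_UN)
  fix X :: "(real ^ 'n) set" and B :: ennreal
  assume cov: "\<And>q. \<exists>\<C>. X \<subseteq> \<Union>(cell ` \<C>) \<and> (\<forall>b\<in>\<C>. q \<le> fst b) \<and>
      emeasure (point_measure UNIV (\<lambda>b. ennreal (1 / real (2 ^ k) ^ fst b))) \<C> \<le> B" and B: "B < \<infinity>"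
  define c where "c = unit_ball_vol (real k) * (real CARD('n) / 2) ^ k"
  have c: "0 \<le> c" by (simp add: c_def)
  have "hausdorff_premeasure k \<delta> X \<le> ennreal c * B" if \<delta>: "0 < \<delta>" for \<delta>
  proof -
    obtain q :: nat where q: "real CARD('n) / \<delta> < 2 ^ q" using real_arch_pow[of 2] by auto
    from cov[of q] obtain \<C> where \<C>: "X \<subseteq> \<Union>(cell ` \<C>)" "\<forall>b\<in>\<C>. q \<le> fst b"
      "emeasure (point_measure UNIV (\<lambda>b. ennreal (1 / real (2 ^ k) ^ fst b))) \<C> \<le> B"
      by (elim exE conjE)
    have "diameter (cell b) \<le> \<delta>" if "b \<in> \<C>" for b
    proof -
      have "diameter (cell b) \<le> real CARD('n) / 2 ^ fst b" by (rule diameter_cell_le)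
      also have "\<dots> \<le> real CARD('n) / 2 ^ q" using bspec[OF \<C>(2) that]
        by (intro divide_left_mono power_increasing) auto
      also have "\<dots> \<le> \<delta>" using q \<delta> by (simp add: field_simps)
      finally show ?thesis .
    qed
    then have "hausdorff_premeasure k \<delta> X \<le>
      emeasure (point_measure UNIV (\<lambda>b. ennreal c * ennreal (1 / real (2 ^ k) ^ fst b))) \<C>"
    proof (intro hausdorff_premeasure_le_cover[OF \<C>(1)])
      fix b :: "nat \<times> (int ^ 'n)"
      have "hausdorff_weight k (cell b) \<le> ennreal (unit_ball_vol (real k) * (real CARD('n) / 2 ^ fst b / 2) ^ k)"
        by (intro hausdorff_weight_le bounded_cell diameter_cell_le)
      also have "unit_ball_vol (real k) * (real CARD('n) / 2 ^ fst b / 2) ^ k = c * (1 / real (2 ^ k) ^ fst b)"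
        by (simp add: c_def power_divide power_mult[symmetric] mult.commute)
      finally show "hausdorff_weight k (cell b) \<le> ennreal c * ennreal (1 / real (2 ^ k) ^ fst b)"
        by (subst ennreal_mult[symmetric]) (use c in simp_all)
    qed (use \<delta> bounded_cell in auto)
    also have "\<dots> = ennreal c * emeasure (point_measure UNIV (\<lambda>b. ennreal (1 / real (2 ^ k) ^ fst b))) \<C>"
      unfolding point_measure_def
      by (simp add: emeasure_density nn_integral_cmult[symmetric] mult.assoc)
    also have "\<dots> \<le> ennreal c * B" using \<C>(3) by (intro mult_left_mono) auto
    finally show ?thesis .
  qed
  then have "hausdorff_measure k X \<le> ennreal c * B"
    unfolding hausdorff_measure_def by (intro SUP_least) auto
  also have "\<dots> < \<infinity>" using B by (simp add: ennreal_mult_less_top)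
  finally show "hausdorff_sigma_finite k X"
    unfolding hausdorff_sigma_finite_def by (intro exI[of _ "\<lambda>_. X"]) auto
qed

section \<open>Koenig's lemma and nets in subspaces\<close>

text \<open>Koenig's lemma for the tree with entries at depth \<open>j\<close> bounded by
  \<open>l j\<close>; \<open>G\<close> singles out the segments that extend to good sequences of
  every length.\<close>

lemma koenig_bounded:
  fixes Q :: "nat list \<Rightarrow> bool"
  assumes "\<And>i. \<exists>t. length t = i \<and> (\<forall>j<i. t ! j \<le> l j) \<and> (\<forall>m\<le>i. Q (take m t))"
  obtains \<sigma> where "\<And>m. Q (map \<sigma> [0..<m])"
proof -
  define T where "T = (\<lambda>i. {t. length t = i \<and> (\<forall>j<i. t ! j \<le> l j) \<and> (\<forall>m\<le>i. Q (take m t))})"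
  have T_take: "take i t \<in> T i" if "t \<in> T j" "i \<le> j" for i j t
    using that by (auto simp: T_def min_def)
  define G where "G = (\<lambda>s. \<forall>i\<ge>length s. \<exists>t\<in>T i. take (length s) t = s)"
  have "\<exists>f. \<forall>n. (length (f n) = n \<and> G (f n)) \<and> (\<exists>a. f (Suc n) = f n @ [a])"
  proof (rule dependent_nat_choice)
    have "G []" using assms by (auto simp: G_def T_def)
    then show "\<exists>s. length s = 0 \<and> G s" by auto
  next
    fix s :: "nat list" and n assume s: "length s = n \<and> G s"
    have "\<exists>a\<le>l n. G (s @ [a])"
    proof (rule ccontr)
      assume "\<not> (\<exists>a\<le>l n. G (s @ [a]))"
      then have "\<forall>a\<in>{..l n}. \<exists>i. Suc n \<le> i \<and> (\<forall>t\<in>T i. take (Suc n) t \<noteq> s @ [a])"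
        using s by (auto simp: G_def)
      then obtain i where i: "\<And>a. a \<le> l n \<Longrightarrow> Suc n \<le> i a"
        "\<And>a t. a \<le> l n \<Longrightarrow> t \<in> T (i a) \<Longrightarrow> take (Suc n) t \<noteq> s @ [a]" by (metis atMost_iff)
      \<comment> \<open>If every admissible extension of \<open>s\<close> died, all of them would be
        dead at this common length, although \<open>s\<close> still extends to it.\<close>
      define j where "j = Max (insert (Suc n) (i ` {..l n}))"
      have j: "Suc n \<le> j" "\<And>a. a \<le> l n \<Longrightarrow> i a \<le> j"
        unfolding j_def by (auto intro: Max_ge simp del: Max_insert)
      have "length s \<le> j" using s j(1) by simp
      then obtain t where t: "t \<in> T j" "take n t = s" using s unfolding G_def by metis
      define a where "a = t ! n"
      have a: "a \<le> l n" "n < length t" using t j(1) by (auto simp: T_def a_def)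
      then have "take (Suc n) (take (i a) t) = s @ [a]"
        using t(2) i(1)[OF a(1)] by (simp add: a_def take_Suc_conv_app_nth min_def)
      then show False using i(2)[OF a(1)] T_take[OF t(1) j(2)[OF a(1)]] by blast
    qed
    then show "\<exists>t. (length t = Suc n \<and> G t) \<and> (\<exists>a. t = s @ [a])"
      using s by (elim exE conjE, intro exI conjI) auto
  qed
  then obtain f where f: "\<And>n. length (f n) = n" "\<And>n. G (f n)" "\<And>n. \<exists>a. f (Suc n) = f n @ [a]"
    by metis
  define \<sigma> where "\<sigma> = (\<lambda>n. last (f (Suc n)))"
  have \<sigma>: "f n = map \<sigma> [0..<n]" for n
  proof (induction n)
    case 0
    then show ?case using f(1)[of 0] by simp
  next
    case (Suc n)
    obtain a where "f (Suc n) = f n @ [a]" using f(3) by blast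
    then show ?case using Suc by (simp add: \<sigma>_def)
  qed
  have "Q (f n)" for n
  proof -
    obtain t where t: "t \<in> T n" "take n t = f n" using f(2)[of n] f(1)[of n] by (auto simp: G_def)
    then have "Q (take n t)" by (auto simp: T_def)
    then show ?thesis using t(2) by simp
  qed
  then show thesis using that \<sigma> by metis
qed

text \<open>A grid of mesh \<open>\<rho> / k\<close> in an orthonormal basis: the rounding errors of
  the \<open>k\<close> coordinates add up to at most \<open>\<rho>\<close>.\<close>

lemma subspace_net:
  fixes V :: "'a::euclidean_space set"
  assumes "subspace V" "dim V = k" "1 \<le> k" "0 \<le> M"
  obtains C where "0 \<le> C" "\<And>\<rho>. 0 < \<rho> \<Longrightarrow> \<rho> \<le> 1 \<Longrightarrow>
    \<exists>D\<subseteq>V. finite D \<and> real (card D) \<le> C / \<rho> ^ k \<and> (\<forall>v\<in>V. norm v \<le> M \<longrightarrow> (\<exists>d\<in>D. dist v d \<le> \<rho>))"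
proof -
  obtain B where B: "B \<subseteq> V" "pairwise orthogonal B" "\<And>b. b \<in> B \<Longrightarrow> norm b = 1" "independent B"
    "card B = dim V" "span B = V"
    using orthonormal_basis_subspace[OF assms(1)] by metis
  have finB: "finite B" using B(4) independent_imp_finite by blast
  have expand: "v = (\<Sum>b\<in>B. (v \<bullet> b) *\<^sub>R b)" if v: "v \<in> V" for v
  proof -
    obtain u where u: "v = (\<Sum>b\<in>B. u b *\<^sub>R b)"
      using v B(6) span_finite[OF finB] by auto
    have "v \<bullet> b = u b" if b: "b \<in> B" for b
    proof -
      have "v \<bullet> b = (\<Sum>c\<in>B. u c * (c \<bullet> b))" by (simp add: u inner_sum_left)
      also have "\<dots> = (\<Sum>c\<in>B. if c = b then u b else 0)"
        using B(2,3) b by (intro sum.cong) (auto simp: pairwise_def orthogonal_def dot_square_norm)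
      finally show ?thesis using b finB by simp
    qed
    then show ?thesis using u by simp
  qed
  \<comment> \<open>Each coordinate takes at most \<open>2 * (M / h + 2) + 1\<close> grid values,
    with \<open>h = \<rho> / k\<close> and \<open>\<rho> \<le> 1\<close>.\<close>
  define C where "C = (2 * M * real k + 5) ^ k"
  have "\<exists>D\<subseteq>V. finite D \<and> real (card D) \<le> C / \<rho> ^ k \<and> (\<forall>v\<in>V. norm v \<le> M \<longrightarrow> (\<exists>d\<in>D. dist v d \<le> \<rho>))"
    if \<rho>: "0 < \<rho>" "\<rho> \<le> 1" for \<rho>
  proof -
    define h where "h = \<rho> / real k"
    have h: "0 < h" using \<rho> assms(3) by (simp add: h_def)
    define m where "m = \<lceil>M / h\<rceil> + 1"
    define pt where "pt = (\<lambda>a :: 'a \<Rightarrow> int. \<Sum>b\<in>B. (h * real_of_int (a b)) *\<^sub>R b)"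
    define I where "I = PiE B (\<lambda>_. {- m..m})"
    have finI: "finite I" unfolding I_def using finB by (intro finite_PiE) auto
    have "0 \<le> M / h" using assms(4) h by simp
    then have m: "0 \<le> m" by (simp add: m_def)
    have "card (pt ` I) \<le> card I" using finI by (rule card_image_le)
    also have "card I = nat (2 * m + 1) ^ k"
      using finB B(5) assms(2) by (simp add: I_def card_PiE)
    finally have "real (card (pt ` I)) \<le> real (nat (2 * m + 1)) ^ k"
      by (metis of_nat_le_iff of_nat_power)
    also have "\<dots> \<le> ((2 * M * real k + 5) / \<rho>) ^ k"
    proof (rule power_mono)
      have "real (nat (2 * m + 1)) = 2 * real_of_int m + 1" using m by simp
      also have "\<dots> \<le> 2 * (M / h + 2) + 1" 
        using of_int_ceiling_le_add_one[of "M / h"] unfolding m_def by (simp del: of_int_ceiling_le_add_one)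
      also have "\<dots> = (2 * M * real k + 5 * \<rho>) / \<rho>" using \<rho> assms(3) by (simp add: h_def field_simps)
      also have "\<dots> \<le> (2 * M * real k + 5) / \<rho>" using \<rho> by (intro divide_right_mono) auto
      finally show "real (nat (2 * m + 1)) \<le> (2 * M * real k + 5) / \<rho>" .
    qed simp
    finally have "real (card (pt ` I)) \<le> C / \<rho> ^ k" by (simp add: C_def power_divide)
    moreover have "pt ` I \<subseteq> V"
      using B(1) assms(1) by (auto simp: pt_def intro!: subspace_sum subspace_scale)
    moreover have "\<exists>d\<in>pt ` I. dist v d \<le> \<rho>" if v: "v \<in> V" "norm v \<le> M" for v
    proof
      define a where "a = restrict (\<lambda>b. \<lfloor>(v \<bullet> b) / h\<rfloor>) B"
      have "\<lfloor>(v \<bullet> b) / h\<rfloor> \<in> {- m..m}" if "b \<in> B" for b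
      proof -
        have "\<bar>v \<bullet> b\<bar> \<le> M" using Cauchy_Schwarz_ineq2[of v b] B(3)[OF that] v(2) by simp
        then have "\<bar>(v \<bullet> b) / h\<bar> \<le> M / h" using h by (simp add: divide_right_mono)
        then show ?thesis unfolding m_def atLeastAtMost_iff by linarith
      qed
      then show "pt a \<in> pt ` I" unfolding a_def I_def by (intro imageI restrict_PiE_iff[THEN iffD2]) blast
      have "dist v (pt a) = norm (\<Sum>b\<in>B. (v \<bullet> b - h * real_of_int (a b)) *\<^sub>R b)"
        using expand[OF v(1)] by (simp add: dist_norm pt_def sum_subtractf scaleR_diff_left)
      also have "\<dots> \<le> (\<Sum>b\<in>B. norm ((v \<bullet> b - h * real_of_int (a b)) *\<^sub>R b))" by (rule norm_sum)
      also have "\<dots> \<le> (\<Sum>b\<in>B. h)"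
      proof (rule sum_mono)
        fix b assume b: "b \<in> B"
        have "\<bar>(v \<bullet> b) / h - real_of_int \<lfloor>(v \<bullet> b) / h\<rfloor>\<bar> \<le> 1" by linarith
        then have "\<bar>(v \<bullet> b) / h - real_of_int \<lfloor>(v \<bullet> b) / h\<rfloor>\<bar> * h \<le> 1 * h"
          using h by (intro mult_right_mono) auto
        also have "\<bar>(v \<bullet> b) / h - real_of_int \<lfloor>(v \<bullet> b) / h\<rfloor>\<bar> * h =
            \<bar>((v \<bullet> b) / h - real_of_int \<lfloor>(v \<bullet> b) / h\<rfloor>) * h\<bar>"
          using h by (simp only: abs_mult abs_of_pos)
        also have "((v \<bullet> b) / h - real_of_int \<lfloor>(v \<bullet> b) / h\<rfloor>) * h = v \<bullet> b - h * real_of_int (a b)"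
          using h b by (simp add: a_def left_diff_distrib)
        finally show "norm ((v \<bullet> b - h * real_of_int (a b)) *\<^sub>R b) \<le> h" using B(3)[OF b] by simp
      qed
      also have "\<dots> = \<rho>" using B(5) assms(2,3) by (simp add: h_def)
      finally show "dist v (pt a) \<le> \<rho>" .
    qed
    ultimately show ?thesis using finI by (intro exI[of _ "pt ` I"]) auto
  qed
  moreover have "0 \<le> C" using assms(4) by (simp add: C_def)
  ultimately show thesis using that by blast
qed

section \<open>The limit set of a tower of cells\<close>

lemma dyadic_scale:
  fixes r :: real
  assumes "0 < r" "r \<le> 1"
  obtains q :: nat where "(1/2) ^ q \<le> r" "r < 2 * (1/2) ^ q"
proof -
  define q where "q = (LEAST q. (1/2) ^ q \<le> r)"
  have "\<exists>q. (1/2) ^ q \<le> r"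
    using real_arch_pow_inv[where x = "1/2", OF assms(1)] by (auto intro: less_imp_le)
  then have q: "(1/2) ^ q \<le> r" unfolding q_def by (rule LeastI_ex)
  have "r < 2 * (1/2) ^ q"
  proof (cases q)
    case (Suc p)
    then have "\<not> (1/2) ^ p \<le> r" using not_less_Least[of p "\<lambda>q. (1/2) ^ q \<le> r"] by (simp add: q_def)
    then show ?thesis using Suc by simp
  qed (use assms in simp)
  then show thesis using q that by blast
qed

lemma sum_le_sum_cover:
  fixes f :: "'b \<Rightarrow> real"
  assumes "finite S" "finite A" "\<And>b. b \<in> S \<Longrightarrow> 0 \<le> f b" "\<And>b. b \<in> S \<Longrightarrow> \<exists>a\<in>A. R a b"
  shows "(\<Sum>b\<in>S. f b) \<le> (\<Sum>a\<in>A. \<Sum>b | b \<in> S \<and> R a b. f b)"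
proof -
  have "(\<Sum>b\<in>S. f b) \<le> (\<Sum>b\<in>S. \<Sum>a\<in>A. if R a b then f b else 0)"
  proof (rule sum_mono)
    fix b assume b: "b \<in> S"
    then obtain a where a: "a \<in> A" "R a b" using assms(4) by blast
    have "f b = (if R a b then f b else 0)" using a by simp
    also have "\<dots> \<le> (\<Sum>a\<in>A. if R a b then f b else 0)"
      using a assms(2,3) b by (intro member_le_sum[where f = "\<lambda>a. if R a b then f b else 0"]) auto
    finally show "f b \<le> (\<Sum>a\<in>A. if R a b then f b else 0)" .
  qed
  also have "\<dots> = (\<Sum>a\<in>A. \<Sum>b\<in>S. if R a b then f b else 0)" by (rule sum.swap)
  also have "\<dots> = (\<Sum>a\<in>A. \<Sum>b | b \<in> S \<and> R a b. f b)"
    by (simp only: sum.inter_filter[OF assms(1)])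
  finally show ?thesis .
qed

text \<open>\<open>wt\<close> and \<open>cell_mass\<close> are \<open>wr\<close> and
  \<open>mass\<close> of the dyadic net, restated so that the geometry below does not depend on the
  \<open>net\<close> locale.\<close>

definition wt :: "nat \<Rightarrow> nat \<Rightarrow> real" where "wt k j = 1 / (2 ^ k) ^ j"

lemma wt_pos: "0 < wt k j"
  by (simp add: wt_def)

lemma wt_add: "wt k (i + j) = wt k i * wt k j"
  by (simp add: wt_def power_add)

lemma wt_eq: "wt k j = ((1/2) ^ j) ^ k"
  by (simp add: wt_def power_divide power_mult[symmetric] mult.commute)

definition cell_mass :: "nat \<Rightarrow> (nat \<times> (int ^ 'n)) set \<Rightarrow> nat \<times> (int ^ 'n) \<Rightarrow> real" where
  "cell_mass k S Q = (\<Sum>b | b \<in> S \<and> fst Q \<le> fst b \<and> cell b \<subseteq> cell Q. wt k (fst b))"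

definition near :: "(int ^ 'n) set" where "near = {v. \<forall>i. \<bar>v $ i\<bar> \<le> 2}"

lemma finite_near: "finite near"
  unfolding near_def by (rule finite_int_vec_box)

text \<open>Moving by less than \<open>2 * (1/2) ^ j\<close> changes each floor at level
  \<open>j\<close> by at most 2. So a cell of \<open>S\<close> meeting the ball lies in a level
  \<open>j\<close> cell whose index differs from that of \<open>x\<close> by an element of
  \<open>near\<close>.\<close>

lemma near_mass:
  fixes S :: "(nat \<times> (int ^ 'n)) set"
  assumes S: "finite S" "\<And>b. b \<in> S \<Longrightarrow> j \<le> fst b" and B: "\<And>Q. fst Q = j \<Longrightarrow> cell_mass k S Q \<le> B"
  shows "(\<Sum>b | b \<in> S \<and> cell b \<inter> ball x (2 * (1/2) ^ j) \<noteq> {}. wt k (fst b)) \<le> real (card (near :: (int ^ 'n) set)) * B"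
proof -
  define A where "A = (\<lambda>v :: int ^ 'n. (j, floor_vec j x + v)) ` near"
  have finA: "finite A" unfolding A_def by (intro finite_imageI finite_near)
  have cover: "\<exists>Q\<in>A. fst Q \<le> fst b \<and> cell b \<subseteq> cell Q" if b: "b \<in> S" "cell b \<inter> ball x (2 * (1/2) ^ j) \<noteq> {}" for b
  proof -
    obtain y where y: "y \<in> cell b" "dist x y < 2 * (1/2) ^ j" using b(2) by auto
    have "\<bar>\<lfloor>2 ^ j * y $ i\<rfloor> - \<lfloor>2 ^ j * x $ i\<rfloor>\<bar> \<le> 2" for i
    proof -
      have "\<bar>y $ i - x $ i\<bar> < 2 * (1/2) ^ j"
        using component_le_norm_cart[of "y - x" i] y(2) by (simp add: dist_norm norm_minus_commute)
      then have "2 ^ j * \<bar>y $ i - x $ i\<bar> < 2 ^ j * (2 * (1/2) ^ j)" by (intro mult_strict_left_mono) auto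
      also have "2 ^ j * (2 * (1/2) ^ j) = (2::real)" by (simp add: power_divide)
      finally have "\<bar>2 ^ j * y $ i - 2 ^ j * x $ i\<bar> < 2"
        by (simp add: abs_mult right_diff_distrib[symmetric] del: right_diff_distrib)
      then show ?thesis by linarith
    qed
    then have "floor_vec j y - floor_vec j x \<in> near" by (simp add: near_def floor_vec_def)
    then have "(j, floor_vec j y) \<in> A" unfolding A_def by (rule rev_image_eqI) simp
    moreover have "cell b \<subseteq> cell (j, floor_vec j y)"
      using floor_vec_coarser[OF S(2)[OF b(1)]] y(1) by (fastforce simp: in_cell_iff)
    ultimately show ?thesis using S(2)[OF b(1)] by (intro bexI[of _ "(j, floor_vec j y)"]) auto
  qed
  let ?T = "{b. b \<in> S \<and> cell b \<inter> ball x (2 * (1/2) ^ j) \<noteq> {}}"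
  have "(\<Sum>b\<in>?T. wt k (fst b)) \<le> (\<Sum>Q\<in>A. \<Sum>b | b \<in> ?T \<and> (fst Q \<le> fst b \<and> cell b \<subseteq> cell Q). wt k (fst b))"
    using finA S(1) cover wt_pos by (intro sum_le_sum_cover) (auto simp: less_imp_le)
  also have "\<dots> \<le> (\<Sum>Q\<in>A. B)"
  proof (rule sum_mono)
    fix Q assume Q: "Q \<in> A"
    have "(\<Sum>b | b \<in> ?T \<and> (fst Q \<le> fst b \<and> cell b \<subseteq> cell Q). wt k (fst b)) \<le> cell_mass k S Q"
      unfolding cell_mass_def using S(1) wt_pos by (intro sum_mono2) (auto simp: less_imp_le)
    also have "\<dots> \<le> B" using Q by (intro B) (auto simp: A_def)
    finally show "(\<Sum>b | b \<in> ?T \<and> (fst Q \<le> fst b \<and> cell b \<subseteq> cell Q). wt k (fst b)) \<le> B" .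
  qed
  also have "\<dots> = real (card A) * B" by simp
  also have "\<dots> \<le> real (card (near :: (int ^ 'n) set)) * B"
  proof (rule mult_right_mono)
    show "real (card A) \<le> real (card (near :: (int ^ 'n) set))"
      unfolding A_def by (simp add: card_image_le[OF finite_near])
    have "0 \<le> cell_mass k S (j, 0)" unfolding cell_mass_def using wt_pos by (intro sum_nonneg) (auto simp: less_imp_le)
    then show "0 \<le> B" using B[of "(j, 0)"] by simp
  qed
  finally show ?thesis .
qed

text \<open>The output of \<open>net_construction\<close> for dyadic cells, except for the condition
  on the Souslin set, which enters only in \<open>limit_set_subset_souslin\<close>.\<close>

locale cell_tower =
  fixes k :: nat and S :: "nat \<Rightarrow> (nat \<times> (int ^ 'n)) set" and l :: "nat \<Rightarrow> nat" and c :: real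
  assumes k: "1 \<le> k"
    and finite_S: "finite (S i)"
    and parent: "b \<in> S (Suc i) \<Longrightarrow> \<exists>a\<in>S i. fst a \<le> fst b \<and> cell b \<subseteq> cell a"
    and level: "b \<in> S i \<Longrightarrow> i \<le> fst b"
    and mass_le: "cell_mass k (S i) Q \<le> wt k (fst Q)"
    and c_pos: "0 < c" and total: "c \<le> (\<Sum>b\<in>S i. wt k (fst b))"
    and level_l: "i < j \<Longrightarrow> b \<in> S j \<Longrightarrow> l i < fst b"
    and mass_l: "i < j \<Longrightarrow> fst Q = l i \<Longrightarrow> cell_mass k (S j) Q \<le> wt k (l i + i)"
begin

text \<open>Closures make the layers compact. A point of the limit set may then miss the half-open
  cells themselves and has to be approximated from inside them.\<close>

definition layer :: "nat \<Rightarrow> (real ^ 'n) set" where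
  "layer i = (\<Union>b\<in>S i. closure (cell b))"

definition limit_set :: "(real ^ 'n) set" where
  "limit_set = (\<Inter>i. layer i)"

definition \<kappa> :: real where "\<kappa> = unit_ball_vol (real k) * (real CARD('n) / 2) ^ k"

lemma \<kappa>_nonneg: "0 \<le> \<kappa>"
  by (simp add: \<kappa>_def)

lemma compact_layer: "compact (layer i)"
  unfolding layer_def using finite_S bounded_cell
  by (intro compact_UN) (auto simp: compact_closure)

lemma layer_decreasing: "i \<le> j \<Longrightarrow> layer j \<subseteq> layer i"
proof (induction j rule: dec_induct)
  case (step j)
  have "layer (Suc j) \<subseteq> layer j"
    unfolding layer_def using parent closure_mono by blast
  then show ?case using step by blast
qed simp

lemma limit_set_subset: "limit_set \<subseteq> layer i"
  by (auto simp: limit_set_def)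

lemma closed_limit_set: "closed limit_set"
  unfolding limit_set_def using compact_layer compact_imp_closed by (intro closed_INT) auto

lemma bounded_limit_set: "bounded limit_set"
  using bounded_subset[OF compact_imp_bounded[OF compact_layer] limit_set_subset] .

text \<open>Every cell of stage \<open>i\<close> has an ancestor in \<open>S 0\<close>, and the mass
  inside that ancestor is at most its weight.\<close>

lemma total_le: "(\<Sum>b\<in>S i. wt k (fst b)) \<le> (\<Sum>b\<in>S 0. wt k (fst b))"
proof -
  have "\<exists>a\<in>S 0. fst a \<le> fst b \<and> cell b \<subseteq> cell a" if "b \<in> S i" for b
    using that
  proof (induction i arbitrary: b)
    case (Suc i)
    then obtain a where "a \<in> S i" "fst a \<le> fst b" "cell b \<subseteq> cell a" using parent by blast
    then show ?case using Suc.IH[of a] order_trans by blast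
  qed auto
  then have "(\<Sum>b\<in>S i. wt k (fst b)) \<le>
      (\<Sum>a\<in>S 0. \<Sum>b | b \<in> S i \<and> (fst a \<le> fst b \<and> cell b \<subseteq> cell a). wt k (fst b))"
    using finite_S wt_pos by (intro sum_le_sum_cover) (auto simp: less_imp_le)
  also have "\<dots> \<le> (\<Sum>a\<in>S 0. wt k (fst a))"
    using mass_le unfolding cell_mass_def by (intro sum_mono) simp
  finally show ?thesis .
qed

lemma premeasure_le:
  assumes "X \<subseteq> (\<Union>b\<in>T. closure (cell b))" "T \<subseteq> S i" "real CARD('n) / 2 ^ i \<le> \<delta>"
  shows "hausdorff_premeasure k \<delta> X \<le> ennreal (\<kappa> * (\<Sum>b\<in>T. wt k (fst b)))"
proof -
  have "hausdorff_premeasure k \<delta> X \<le> emeasure (point_measure UNIV (\<lambda>b. ennreal (\<kappa> * wt k (fst b)))) T"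
  proof (rule hausdorff_premeasure_le_cover[OF assms(1)])
    have "0 \<le> real CARD('n) / 2 ^ i" by simp
    then show "0 \<le> \<delta>" using assms(3) by linarith
  next
    fix b assume "b \<in> T"
    then have "i \<le> fst b" using assms(2) level by blast
    then have "real CARD('n) / 2 ^ fst b \<le> real CARD('n) / 2 ^ i"
      by (intro divide_left_mono power_increasing) auto
    then show "bounded (closure (cell b)) \<and> diameter (closure (cell b)) \<le> \<delta>"
      using bounded_cell[of b] diameter_cell_le[of b] assms(3) by (simp add: diameter_closure bounded_closure)
  next
    fix b :: "nat \<times> (int ^ 'n)"
    have "hausdorff_weight k (closure (cell b)) \<le> ennreal (unit_ball_vol (real k) * (real CARD('n) / 2 ^ fst b / 2) ^ k)"
      using diameter_cell_le[of b] bounded_cell[of b]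
      by (intro hausdorff_weight_le) (auto simp: diameter_closure bounded_closure)
    also have "unit_ball_vol (real k) * (real CARD('n) / 2 ^ fst b / 2) ^ k = \<kappa> * wt k (fst b)"
      by (simp add: \<kappa>_def wt_def power_divide power_mult[symmetric] mult.commute)
    finally show "hausdorff_weight k (closure (cell b)) \<le> ennreal (\<kappa> * wt k (fst b))" .
  qed
  also have "\<dots> = (\<Sum>b\<in>T. ennreal (\<kappa> * wt k (fst b)))"
    using finite_subset[OF assms(2) finite_S] by (intro emeasure_point_measure_finite2) auto
  also have "\<dots> = ennreal (\<kappa> * (\<Sum>b\<in>T. wt k (fst b)))"
    using \<kappa>_nonneg wt_pos[of k] by (subst sum_ennreal) (auto simp: sum_distrib_left less_imp_le)
  finally show ?thesis .
qed

lemma fine_index: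
  assumes "0 < \<delta>"
  obtains i where "\<And>j. i \<le> j \<Longrightarrow> real CARD('n) / 2 ^ j \<le> \<delta>"
proof -
  obtain i :: nat where i: "real CARD('n) / \<delta> < 2 ^ i" using real_arch_pow[of 2] by auto
  have "real CARD('n) / 2 ^ j \<le> \<delta>" if "i \<le> j" for j
  proof -
    have "real CARD('n) / 2 ^ j \<le> real CARD('n) / 2 ^ i"
      using that by (intro divide_left_mono power_increasing) auto
    also have "\<dots> \<le> \<delta>" using i assms by (simp add: field_simps)
    finally show ?thesis .
  qed
  then show thesis using that by blast
qed

section \<open>Finite and positive measure of the limit set\<close>

lemma limit_set_finite_measure: "hausdorff_measure k limit_set < \<infinity>"
proof -
  have "hausdorff_premeasure k \<delta> limit_set \<le> ennreal (\<kappa> * (\<Sum>b\<in>S 0. wt k (fst b)))" if \<delta>: "0 < \<delta>" for \<delta>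
  proof -
    obtain i where i: "real CARD('n) / 2 ^ i \<le> \<delta>" using fine_index[OF \<delta>] by blast
    have "hausdorff_premeasure k \<delta> limit_set \<le> ennreal (\<kappa> * (\<Sum>b\<in>S i. wt k (fst b)))"
      using limit_set_subset[of i] i by (intro premeasure_le) (auto simp: layer_def)
    also have "\<dots> \<le> ennreal (\<kappa> * (\<Sum>b\<in>S 0. wt k (fst b)))"
      using total_le \<kappa>_nonneg by (intro ennreal_leI mult_left_mono)
    finally show ?thesis .
  qed
  then have "hausdorff_measure k limit_set \<le> ennreal (\<kappa> * (\<Sum>b\<in>S 0. wt k (fst b)))"
    unfolding hausdorff_measure_def by (intro SUP_least) auto
  then show ?thesis by (simp add: le_less_trans)
qed

lemma layer_subset_open:
  assumes "open U" "limit_set \<subseteq> U"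
  obtains i where "layer i \<subseteq> U"
proof (rule ccontr)
  assume "\<not> thesis"
  then have "layer i - U \<noteq> {}" for i using that by blast
  moreover have "compact (layer i - U)" for i using compact_layer assms(1) by (rule compact_diff)
  moreover have "layer j - U \<subseteq> layer i - U" if "i \<le> j" for i j using layer_decreasing[OF that] by blast
  ultimately have "\<Inter>(range (\<lambda>i. layer i - U)) \<noteq> {}" by (intro compact_nest) auto
  then show False using assms(2) by (auto simp: limit_set_def)
qed

definition c0 :: real where "c0 = real (card (near :: (int ^ 'n) set))"

lemma c0_pos: "0 < c0"
proof -
  have "(0 :: int ^ 'n) \<in> near" by (simp add: near_def)
  moreover have "finite (near :: (int ^ 'n) set)" by (rule finite_near)
  ultimately show ?thesis unfolding c0_def by (auto simp: card_gt_0_iff)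
qed

text \<open>Enlarging the sets to open balls of dyadic radius lets finitely many of them cover a
  whole layer. At a late stage the total weight, at least \<open>c\<close>, is shared among these
  balls, and by \<open>near_mass\<close> a ball of scale \<open>q\<close> receives at most
  \<open>c0 * wt k q\<close>.\<close>

lemma cover_sum_ge:
  fixes C :: "nat \<Rightarrow> (real ^ 'n) set"
  assumes C: "limit_set \<subseteq> (\<Union>i. C i)" "\<And>i. bounded (C i)" "\<And>i. diameter (C i) \<le> 1"
  shows "\<exists>J. finite J \<and> (\<forall>j\<in>J. C j \<noteq> {}) \<and> c / (2 * c0) \<le> (\<Sum>j\<in>J. diameter (C j) ^ k)"
proof -
  have "0 < c / (4 * c0)" using c_pos c0_pos by simp
  \<comment> \<open>Sets of diameter 0 need a positive radius. The radii are padded by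
    \<open>(1/2) ^ (i + p)\<close>, and this \<open>p\<close> makes the total cost of padding less
    than \<open>c / 2\<close>.\<close>
  then obtain p :: nat where p: "(1/2) ^ p < c / (4 * c0)" using real_arch_pow_inv[where x = "1/2"] by auto
  define r where "r = (\<lambda>i. max (diameter (C i)) ((1/2) ^ (i + p)))"
  have r: "0 < r i" "r i \<le> 1" "diameter (C i) \<le> r i" for i
  proof -
    have "(0::real) < (1/2) ^ (i + p)" by simp
    then show "0 < r i" unfolding r_def by (rule less_le_trans) simp
    have "(1/2::real) ^ (i + p) \<le> 1" by (intro power_le_one) auto
    then show "r i \<le> 1" "diameter (C i) \<le> r i" using C(3) by (auto simp: r_def)
  qed
  have r_pow: "r i ^ k \<le> diameter (C i) ^ k + (1/2) ^ (i + p)" for i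
  proof (cases "diameter (C i) \<le> (1/2) ^ (i + p)")
    case True
    then have "r i = (1/2) ^ (i + p)" by (simp add: r_def)
    moreover have "((1/2::real) ^ (i + p)) ^ k \<le> ((1/2) ^ (i + p)) ^ 1"
      using k by (intro power_decreasing power_le_one) auto
    ultimately show ?thesis using diameter_ge_0[OF C(2), of i] by (simp add: add_increasing)
  next
    case False
    then show ?thesis by (simp add: r_def)
  qed
  have "\<exists>q::nat. (1/2) ^ q \<le> r i \<and> r i < 2 * (1/2) ^ q" for i
    using dyadic_scale[OF r(1,2)[of i]] by metis
  then obtain q :: "nat \<Rightarrow> nat" where q: "\<And>i. (1/2) ^ q i \<le> r i" "\<And>i. r i < 2 * (1/2) ^ q i" by metis
  define x where "x = (\<lambda>i. SOME y. y \<in> C i)"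
  \<comment> \<open>Empty sets get no ball, so that the final index set \<open>J\<close> avoids
    them: their Hausdorff weight is 0 and not given by the diameter formula.\<close>
  define U where "U = (\<lambda>i. if C i = {} then {} else ball (x i) (2 * (1/2) ^ q i))"
  have CU: "C i \<subseteq> U i" for i
  proof
    fix y assume y: "y \<in> C i"
    then have "x i \<in> C i" unfolding x_def by (rule someI)
    then have "dist (x i) y \<le> diameter (C i)" using diameter_bounded_bound[OF C(2)] y by blast
    then show "y \<in> U i" using y r(3)[of i] q(2)[of i] by (auto simp: U_def)
  qed
  have openU: "open (U i)" for i by (simp add: U_def)
  have "limit_set \<subseteq> (\<Union>i. U i)" using C(1) CU by blast
  moreover have "open (\<Union>i. U i)" using openU by blast
  ultimately obtain m where m: "layer m \<subseteq> (\<Union>i. U i)" using layer_subset_open by blast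
  obtain J0 where J0: "finite J0" "layer m \<subseteq> (\<Union>i\<in>J0. U i)"
    using compactE_image[OF compact_layer[of m], of UNIV U] openU m by metis
  define J where "J = {j \<in> J0. C j \<noteq> {}}"
  have finJ: "finite J" using J0(1) by (simp add: J_def)
  have J: "layer m \<subseteq> (\<Union>i\<in>J. U i)"
  proof
    fix y assume "y \<in> layer m"
    then obtain i where "i \<in> J0" "y \<in> U i" using J0(2) by blast
    then show "y \<in> (\<Union>i\<in>J. U i)" unfolding J_def U_def by (auto split: if_splits)
  qed
  \<comment> \<open>Late enough that every cell of \<open>S n\<close> has level at least
    \<open>q j\<close> for all chosen balls, as \<open>near_mass\<close> requires.\<close>
  define n where "n = m + (\<Sum>j\<in>J. q j)"
  have qn: "q j \<le> n" if "j \<in> J" for j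
    using member_le_sum[OF that, of q] finJ by (simp add: n_def)
  have "c \<le> (\<Sum>b\<in>S n. wt k (fst b))" by (rule total)
  also have "\<dots> \<le> (\<Sum>j\<in>J. \<Sum>b | b \<in> S n \<and> cell b \<inter> ball (x j) (2 * (1/2) ^ q j) \<noteq> {}. wt k (fst b))"
  proof (rule sum_le_sum_cover[OF finite_S finJ])
    fix b assume b: "b \<in> S n"
    obtain y where y: "y \<in> cell b" using cell_nonempty by blast
    then have "y \<in> layer n" using b closure_subset by (auto simp: layer_def)
    then have "y \<in> layer m" using layer_decreasing[of m n] by (auto simp: n_def)
    then obtain j where "j \<in> J" "y \<in> U j" using J by blast
    then show "\<exists>j\<in>J. cell b \<inter> ball (x j) (2 * (1/2) ^ q j) \<noteq> {}"
      using y by (intro bexI[of _ j]) (auto simp: U_def split: if_splits)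
  qed (use wt_pos in \<open>auto simp: less_imp_le\<close>)
  also have "\<dots> \<le> (\<Sum>j\<in>J. c0 * wt k (q j))"
  proof (rule sum_mono)
    fix j assume j: "j \<in> J"
    show "(\<Sum>b | b \<in> S n \<and> cell b \<inter> ball (x j) (2 * (1/2) ^ q j) \<noteq> {}. wt k (fst b)) \<le> c0 * wt k (q j)"
      unfolding c0_def
    proof (rule near_mass[OF finite_S])
      show "q j \<le> fst b" if "b \<in> S n" for b using qn[OF j] level[OF that] by simp
      show "cell_mass k (S n) Q \<le> wt k (q j)" if "fst Q = q j" for Q
        using mass_le[of n Q] that by simp
    qed
  qed
  also have "\<dots> = c0 * (\<Sum>j\<in>J. wt k (q j))" by (simp add: sum_distrib_left)
  also have "\<dots> \<le> c0 * (\<Sum>j\<in>J. diameter (C j) ^ k + (1/2) ^ (j + p))"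
  proof (intro mult_left_mono sum_mono)
    fix j
    have "wt k (q j) \<le> r j ^ k" unfolding wt_eq using q(1)[of j] by (intro power_mono) auto
    then show "wt k (q j) \<le> diameter (C j) ^ k + (1/2) ^ (j + p)" using r_pow[of j] by simp
  qed (use c0_pos in simp)
  also have "\<dots> = c0 * (\<Sum>j\<in>J. diameter (C j) ^ k) + c0 * (1/2) ^ p * (\<Sum>j\<in>J. (1/2) ^ j)"
    by (simp add: sum.distrib power_add sum_distrib_left algebra_simps)
  also have "\<dots> \<le> c0 * (\<Sum>j\<in>J. diameter (C j) ^ k) + c0 * (1/2) ^ p * 2"
  proof -
    have "(\<Sum>j\<in>J. (1/2::real) ^ j) \<le> (\<Sum>j. (1/2) ^ j)"
      using finJ by (intro sum_le_suminf summable_geometric) auto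
    also have "\<dots> = 2" by (subst suminf_geometric) auto
    finally show ?thesis using c0_pos by (intro add_left_mono mult_left_mono) auto
  qed
  also have "\<dots> \<le> c0 * (\<Sum>j\<in>J. diameter (C j) ^ k) + c / 2"
    using p c0_pos by (simp add: field_simps)
  finally have "c / (2 * c0) \<le> (\<Sum>j\<in>J. diameter (C j) ^ k)" using c0_pos by (simp add: field_simps)
  then show ?thesis using finJ by (intro exI[of _ J]) (auto simp: J_def)
qed

lemma limit_set_positive_measure: "0 < hausdorff_measure k limit_set"
proof -
  define \<epsilon> where "\<epsilon> = unit_ball_vol (real k) / 2 ^ k * (c / (2 * c0))"
  have "0 < unit_ball_vol (real k)" by simp
  then have \<epsilon>: "0 < \<epsilon>" using c_pos c0_pos by (simp add: \<epsilon>_def)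
  have "ennreal \<epsilon> \<le> hausdorff_premeasure k 1 limit_set"
    unfolding hausdorff_premeasure_def
  proof (rule INF_greatest)
    fix C :: "nat \<Rightarrow> (real ^ 'n) set"
    assume "C \<in> {C. limit_set \<subseteq> (\<Union>i. C i) \<and> (\<forall>i. bounded (C i) \<and> diameter (C i) \<le> 1)}"
    then obtain J where J: "finite J" "\<And>j. j \<in> J \<Longrightarrow> C j \<noteq> {}"
      "c / (2 * c0) \<le> (\<Sum>j\<in>J. diameter (C j) ^ k)" and bd: "\<And>i. bounded (C i)"
      using cover_sum_ge[of C] by blast
    have "\<epsilon> \<le> unit_ball_vol (real k) / 2 ^ k * (\<Sum>j\<in>J. diameter (C j) ^ k)"
      unfolding \<epsilon>_def using J(3) by (intro mult_left_mono) auto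
    also have "\<dots> = (\<Sum>j\<in>J. unit_ball_vol (real k) * (diameter (C j) / 2) ^ k)"
      by (simp add: sum_distrib_left power_divide)
    finally have "ennreal \<epsilon> \<le> ennreal (\<Sum>j\<in>J. unit_ball_vol (real k) * (diameter (C j) / 2) ^ k)"
      by (rule ennreal_leI)
    also have "\<dots> = (\<Sum>j\<in>J. ennreal (unit_ball_vol (real k) * (diameter (C j) / 2) ^ k))"
      using diameter_ge_0[OF bd] by (intro sum_ennreal[symmetric]) auto
    also have "\<dots> = (\<Sum>j\<in>J. hausdorff_weight k (C j))"
      using J(2) by (intro sum.cong) (auto simp: hausdorff_weight_def)
    also have "\<dots> \<le> (\<Sum>i. hausdorff_weight k (C i))" using J(1) by (intro sum_le_suminf) auto
    finally show "ennreal \<epsilon> \<le> (\<Sum>i. hausdorff_weight k (C i))" .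
  qed
  also have "\<dots> \<le> hausdorff_measure k limit_set"
    unfolding hausdorff_measure_def by (intro SUP_upper) auto
  finally have "ennreal \<epsilon> \<le> hausdorff_measure k limit_set" .
  moreover have "0 < ennreal \<epsilon>" using \<epsilon> by simp
  ultimately show ?thesis by (rule less_le_trans[rotated])
qed

text \<open>At scale \<open>2 ^ - l i\<close> a bounded piece of a Lipschitz graph needs only \<open>O(2 ^ (k * l i))\<close> balls,
  each of which meets cells of total weight at most \<open>O(2 ^ (- k * (l i + i)))\<close>.\<close>

lemma limit_set_purely_unrectifiable: "purely_unrectifiable k limit_set"
  unfolding purely_unrectifiable_def
proof (intro allI impI)
  fix \<Gamma> :: "(real ^ 'n) set"
  assume "lipschitz_graph k \<Gamma>"
  then obtain V g L where V: "subspace V" "dim V = k" and g: "g ` V \<subseteq> orthogonal_comp V"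
    and lip: "L-lipschitz_on V g" and \<Gamma>: "\<Gamma> = {x + g x | x. x \<in> V}"
    unfolding lipschitz_graph_def by blast
  have L: "0 \<le> L" using lip lipschitz_on_nonneg by blast
  obtain M where M: "0 < M" "\<And>x. x \<in> limit_set \<Longrightarrow> norm x \<le> M"
    using bounded_limit_set bounded_pos by metis
  obtain D0 where D0: "0 \<le> D0" "\<And>\<rho>. 0 < \<rho> \<Longrightarrow> \<rho> \<le> 1 \<Longrightarrow>
    \<exists>D\<subseteq>V. finite D \<and> real (card D) \<le> D0 / \<rho> ^ k \<and> (\<forall>v\<in>V. norm v \<le> M \<longrightarrow> (\<exists>d\<in>D. dist v d \<le> \<rho>))"
    using subspace_net[OF V k, of M] M(1) by (metis less_imp_le)
  define \<gamma> where "\<gamma> = D0 * (2 * (1 + L)) ^ k * c0"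
  have \<gamma>: "0 \<le> \<gamma>" using D0(1) L c0_pos by (simp add: \<gamma>_def)
  have bound: "hausdorff_premeasure k \<delta> (limit_set \<inter> \<Gamma>) \<le> ennreal (\<kappa> * (\<gamma> * wt k i))"
    if i: "real CARD('n) / 2 ^ Suc i \<le> \<delta>" for i \<delta>
  proof -
    \<comment> \<open>Base points at distance at most \<open>\<rho>\<close> have graph points at
      distance at most \<open>(1 + L) * \<rho>\<close>, half of \<open>2 ^ - l i\<close>.\<close>
    define \<rho> where "\<rho> = (1/2) ^ l i / (2 * (1 + L))"
    have l1: "(1/2::real) ^ l i \<le> 1" by (intro power_le_one) auto
    have half: "a * (z / (2 * a)) = z / 2" if "a \<noteq> 0" for a z :: real using that by simp
    have "(1 + L) * \<rho> = (1/2) ^ l i / 2" unfolding \<rho>_def by (rule half) (use L in simp)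
    moreover have "(1/2) ^ l i / 2 < (1/2::real) ^ l i" by simp
    ultimately have "(1 + L) * \<rho> < (1/2) ^ l i" by metis
    then have \<rho>: "0 < \<rho>" "\<rho> \<le> 1" "(1 + L) * \<rho> < (1/2) ^ l i"
      using L l1 by (auto simp: \<rho>_def divide_le_eq)
    obtain D where D: "D \<subseteq> V" "finite D" "real (card D) \<le> D0 / \<rho> ^ k"
      "\<And>v. v \<in> V \<Longrightarrow> norm v \<le> M \<Longrightarrow> \<exists>d\<in>D. dist v d \<le> \<rho>"
      using D0(2)[OF \<rho>(1,2)] by blast
    \<comment> \<open>\<open>Suc i\<close> is the first stage at which \<open>mass_l\<close> bounds
      the mass in cells of level \<open>l i\<close>.\<close>
    define T where "T = {b \<in> S (Suc i). closure (cell b) \<inter> (limit_set \<inter> \<Gamma>) \<noteq> {}}"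
    have finT: "finite T" using finite_S by (simp add: T_def)
    have "(\<Sum>b\<in>T. wt k (fst b)) \<le> (\<Sum>d\<in>D. \<Sum>b | b \<in> T \<and> cell b \<inter> ball (d + g d) (2 * (1/2) ^ l i) \<noteq> {}. wt k (fst b))"
    proof (rule sum_le_sum_cover[OF finT D(2)])
      fix b assume "b \<in> T"
      then obtain y where y: "y \<in> closure (cell b)" "y \<in> limit_set" "y \<in> \<Gamma>" by (auto simp: T_def)
      then obtain v where v: "v \<in> V" "y = v + g v" by (auto simp: \<Gamma>)
      \<comment> \<open>Orthogonality keeps the base point \<open>v\<close> in the ball of radius
        \<open>M\<close> on which the net was built.\<close>
      have "orthogonal v (g v)" using g v(1) by (auto simp: orthogonal_comp_def)
      then have "norm y ^ 2 = norm v ^ 2 + norm (g v) ^ 2" using v(2) norm_add_Pythagorean by blast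
      then have "norm v ^ 2 \<le> norm y ^ 2" by simp
      then have "norm v \<le> norm y" by simp
      then have "norm v \<le> M" using M(2)[OF y(2)] by simp
      then obtain d where d: "d \<in> D" "dist v d \<le> \<rho>" using D(4)[OF v(1)] by blast
      have "dist y (d + g d) \<le> dist v d + dist (g v) (g d)" unfolding v(2) by (rule dist_triangle_add)
      also have "\<dots> \<le> dist v d + L * dist v d"
        using lipschitz_onD[OF lip v(1)] d(1) D(1) by auto
      also have "\<dots> = (1 + L) * dist v d" by (simp add: algebra_simps)
      also have "\<dots> \<le> (1 + L) * \<rho>" using d(2) L by (intro mult_left_mono) auto
      finally have dy: "dist y (d + g d) < (1/2) ^ l i" using \<rho>(3) by simp
      \<comment> \<open>\<open>y\<close> lies only in the closure of the cell; moving to a point of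
        the cell accounts for the radius \<open>2 * (1/2) ^ l i\<close>.\<close>
      obtain x where x: "x \<in> cell b" "dist x y < (1/2) ^ l i"
        using y(1) closure_approachableD[of y "cell b" "(1/2) ^ l i"] by (auto simp: dist_commute)
      have "dist (d + g d) x < 2 * (1/2) ^ l i"
        using dist_triangle[of "d + g d" x y] dy x(2) by (simp add: dist_commute)
      then show "\<exists>d\<in>D. cell b \<inter> ball (d + g d) (2 * (1/2) ^ l i) \<noteq> {}"
        using d(1) x(1) by (intro bexI[of _ d]) (auto simp: disjoint_iff)
    qed (use wt_pos in \<open>auto simp: less_imp_le\<close>)
    also have "\<dots> \<le> (\<Sum>d\<in>D. c0 * wt k (l i + i))"
    proof (rule sum_mono)
      fix d
      have "(\<Sum>b | b \<in> T \<and> cell b \<inter> ball (d + g d) (2 * (1/2) ^ l i) \<noteq> {}. wt k (fst b)) \<le>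
          (\<Sum>b | b \<in> S (Suc i) \<and> cell b \<inter> ball (d + g d) (2 * (1/2) ^ l i) \<noteq> {}. wt k (fst b))"
        using finite_S wt_pos by (intro sum_mono2) (auto simp: T_def less_imp_le)
      also have "\<dots> \<le> c0 * wt k (l i + i)"
        unfolding c0_def using level_l[of i "Suc i"] mass_l[of i "Suc i"]
        by (intro near_mass[OF finite_S]) (auto simp: less_imp_le)
      finally show "(\<Sum>b | b \<in> T \<and> cell b \<inter> ball (d + g d) (2 * (1/2) ^ l i) \<noteq> {}. wt k (fst b)) \<le>
        c0 * wt k (l i + i)" .
    qed
    also have "\<dots> = real (card D) * (c0 * wt k (l i + i))" by simp
    also have "\<dots> \<le> D0 / \<rho> ^ k * (c0 * wt k (l i + i))"
      using D(3) c0_pos wt_pos[of k "l i + i"] by (intro mult_right_mono) auto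
    \<comment> \<open>The number of balls contributes a factor \<open>1 / wt k (l i)\<close>, which
      cancels against the weight; the reduction \<open>wt k i\<close> is what remains.\<close>
    also have "\<dots> = \<gamma> * wt k i"
      using wt_pos[of k "l i"] by (simp add: \<rho>_def \<gamma>_def wt_add power_divide power_mult_distrib wt_eq[of k "l i"])
    finally have T: "(\<Sum>b\<in>T. wt k (fst b)) \<le> \<gamma> * wt k i" .
    have "hausdorff_premeasure k \<delta> (limit_set \<inter> \<Gamma>) \<le> ennreal (\<kappa> * (\<Sum>b\<in>T. wt k (fst b)))"
    proof (rule premeasure_le[OF _ _ i])
      show "limit_set \<inter> \<Gamma> \<subseteq> (\<Union>b\<in>T. closure (cell b))"
        using limit_set_subset[of "Suc i"] by (fastforce simp: T_def layer_def)
    qed (auto simp: T_def)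
    also have "\<dots> \<le> ennreal (\<kappa> * (\<gamma> * wt k i))"
      using T \<kappa>_nonneg by (intro ennreal_leI mult_left_mono)
    finally show ?thesis .
  qed
  have "hausdorff_premeasure k \<delta> (limit_set \<inter> \<Gamma>) = 0" if \<delta>: "0 < \<delta>" for \<delta>
  proof -
    obtain i0 where i0: "\<And>j. i0 \<le> j \<Longrightarrow> real CARD('n) / 2 ^ j \<le> \<delta>" using fine_index[OF \<delta>] by blast
    have "(\<lambda>i. (1 / 2 ^ k :: real) ^ i) \<longlonglongrightarrow> 0"
      using k by (intro LIMSEQ_power_zero) (auto simp: power_gt1_lemma one_less_power)
    then have "(\<lambda>i. \<kappa> * (\<gamma> * wt k i)) \<longlonglongrightarrow> \<kappa> * (\<gamma> * 0)"
      by (intro tendsto_mult_left) (simp add: wt_def power_divide)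
    then have "(\<lambda>i. ennreal (\<kappa> * (\<gamma> * wt k i))) \<longlonglongrightarrow> ennreal (\<kappa> * (\<gamma> * 0))" by (rule tendsto_ennrealI)
    moreover have "\<forall>\<^sub>F i in sequentially. hausdorff_premeasure k \<delta> (limit_set \<inter> \<Gamma>) \<le> ennreal (\<kappa> * (\<gamma> * wt k i))"
      by (intro eventually_sequentiallyI[of i0] bound i0) simp
    ultimately have "hausdorff_premeasure k \<delta> (limit_set \<inter> \<Gamma>) \<le> ennreal (\<kappa> * (\<gamma> * 0))"
      by (intro tendsto_lowerbound[OF _ _ sequentially_bot])
    then show ?thesis by simp
  qed
  then show "hausdorff_measure k (limit_set \<inter> \<Gamma>) = 0"
    unfolding hausdorff_measure_def by (intro SUP_eq_const) auto
qed

end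

section \<open>Souslin sets\<close>

text \<open>Entries are bounded by \<open>ns\<close> rather than prescribed, so that the sets
  increase in the last bound and only finitely many initial segments of a given length
  compete.\<close>

definition branches :: "(nat list \<Rightarrow> 'a set) \<Rightarrow> nat list \<Rightarrow> 'a set" where
  "branches A ns =
     {x. \<exists>\<sigma>. (\<forall>j<length ns. \<sigma> j \<le> ns ! j) \<and> (\<forall>m. x \<in> A (map \<sigma> [0..<Suc m]))}"

lemma branches_Nil: "branches A [] = (\<Union>\<sigma>. \<Inter>m. A (map \<sigma> [0..<Suc m]))"
  by (auto simp: branches_def)

lemma branches_append: "branches A ns = (\<Union>l. branches A (ns @ [l]))"
proof
  show "branches A ns \<subseteq> (\<Union>l. branches A (ns @ [l]))"
  proof
    fix x assume "x \<in> branches A ns"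
    then obtain \<sigma> where \<sigma>: "\<forall>j<length ns. \<sigma> j \<le> ns ! j" "\<forall>m. x \<in> A (map \<sigma> [0..<Suc m])"
      unfolding branches_def by blast
    have "\<forall>j<length (ns @ [\<sigma> (length ns)]). \<sigma> j \<le> (ns @ [\<sigma> (length ns)]) ! j"
      using \<sigma>(1) by (auto simp: nth_append less_Suc_eq)
    then have "x \<in> branches A (ns @ [\<sigma> (length ns)])" using \<sigma>(2) unfolding branches_def by blast
    then show "x \<in> (\<Union>l. branches A (ns @ [l]))" by blast
  qed
  show "(\<Union>l. branches A (ns @ [l])) \<subseteq> branches A ns"
  proof
    fix x assume "x \<in> (\<Union>l. branches A (ns @ [l]))"
    then obtain l \<sigma> where \<sigma>: "\<forall>j<length (ns @ [l]). \<sigma> j \<le> (ns @ [l]) ! j"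
      "\<forall>m. x \<in> A (map \<sigma> [0..<Suc m])"
      unfolding branches_def by blast
    have "\<sigma> j \<le> ns ! j" if "j < length ns" for j
      using \<sigma>(1) that by (auto simp: nth_append dest: spec[of _ j])
    then show "x \<in> branches A ns" using \<sigma>(2) unfolding branches_def by blast
  qed
qed

lemma incseq_branches: "incseq (\<lambda>l. branches A (ns @ [l]))"
  unfolding incseq_def branches_def
proof (intro allI impI subsetI CollectI, elim CollectE exE conjE)
  fix m n x \<sigma>
  assume "m \<le> n" and \<sigma>: "\<forall>j<length (ns @ [m]). \<sigma> j \<le> (ns @ [m]) ! j"
    "\<forall>m. x \<in> A (map \<sigma> [0..<Suc m])"
  then have "\<forall>j<length (ns @ [n]). \<sigma> j \<le> (ns @ [n]) ! j"
    by (fastforce simp: nth_append less_Suc_eq)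
  then show "\<exists>\<sigma>. (\<forall>j<length (ns @ [n]). \<sigma> j \<le> (ns @ [n]) ! j) \<and> (\<forall>m. x \<in> A (map \<sigma> [0..<Suc m]))"
    using \<sigma>(2) by blast
qed

text \<open>The sets \<open>branches\<close> need not be closed, so a limit point is placed in
  larger closed sets that test only finitely many conditions. The bounds \<open>l\<close> make the
  tree of initial segments finitely branching, and Koenig's lemma merges the partial branches
  through \<open>x\<close> into one infinite branch.\<close>

lemma (in cell_tower) limit_set_subset_souslin:
  assumes A: "\<And>s. closed (A s)"
    and meets: "\<And>i b. b \<in> S i \<Longrightarrow> branches A (map l [0..<i]) \<inter> cell b \<noteq> {}"
  shows "limit_set \<subseteq> (\<Union>\<sigma>. \<Inter>m. A (map \<sigma> [0..<Suc m]))"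
proof
  fix x assume x: "x \<in> limit_set"
  define Box where "Box = (\<lambda>i. {t. length t = i \<and> (\<forall>j<i. t ! j \<le> l j)})"
  have fin: "finite (Box i)" for i
  proof (rule finite_subset)
    show "Box i \<subseteq> {t. set t \<subseteq> {..\<Sum>j<i. l j} \<and> length t = i}"
    proof (clarsimp simp: Box_def in_set_conv_nth)
      fix t :: "nat list" and j assume "\<forall>j<length t. t ! j \<le> l j" "j < length t" "i = length t"
      then show "t ! j \<le> (\<Sum>j<length t. l j)"
        using member_le_sum[of j "{..<length t}" l] by fastforce
    qed
  qed (simp add: finite_lists_length_eq)
  \<comment> \<open>A finite union of closed sets, since \<open>Box i\<close> is finite. The index
    \<open>m\<close> starts at 1 because the Souslin operation uses only nonempty segments.\<close>
  define Z where "Z = (\<lambda>i. \<Union>t\<in>Box i. \<Inter>m\<in>{1..i}. A (take m t))"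
  have "closed (Z i)" for i
    unfolding Z_def using fin A by (intro closed_UN closed_INT) auto
  have sub: "branches A (map l [0..<j]) \<subseteq> Z i" if "i \<le> j" for i j
  proof
    fix y assume "y \<in> branches A (map l [0..<j])"
    then obtain \<sigma> where \<sigma>: "\<And>j'. j' < j \<Longrightarrow> \<sigma> j' \<le> l j'" "\<And>m. y \<in> A (map \<sigma> [0..<Suc m])"
      unfolding branches_def by auto
    have "map \<sigma> [0..<i] \<in> Box i" using \<sigma>(1) that by (auto simp: Box_def)
    moreover have "y \<in> A (take m (map \<sigma> [0..<i]))" if "m \<in> {1..i}" for m
    proof -
      have "Suc (m - 1) = m" "m \<le> i" using that by auto
      then show ?thesis using \<sigma>(2)[of "m - 1"] by (simp only: take_map take_upt) simp
    qed
    ultimately show "y \<in> Z i" unfolding Z_def by blast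
  qed
  have "x \<in> closure (Z i)" for i
    unfolding closure_approachable
  proof (intro allI impI)
    fix \<epsilon> :: real assume "0 < \<epsilon>"
    then obtain i0 where i0: "\<And>j. i0 \<le> j \<Longrightarrow> real CARD('n) / 2 ^ j \<le> \<epsilon> / 2"
      using fine_index[of "\<epsilon> / 2"] by auto
    define j where "j = max i i0"
    obtain b where b: "b \<in> S j" "x \<in> closure (cell b)"
      using x limit_set_subset[of j] by (auto simp: layer_def)
    obtain y where y: "y \<in> branches A (map l [0..<j])" "y \<in> cell b" using meets[OF b(1)] by blast
    have "dist y x \<le> diameter (closure (cell b))"
      using y(2) b(2) closure_subset[of "cell b"] bounded_cell[of b]
      by (intro diameter_bounded_bound) (auto simp: bounded_closure)
    also have "\<dots> \<le> real CARD('n) / 2 ^ fst b"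
      using diameter_cell_le[of b] bounded_cell[of b] by (simp add: diameter_closure)
    also have "\<dots> \<le> \<epsilon> / 2" using level[OF b(1)] by (intro i0) (simp add: j_def)
    finally have "dist y x < \<epsilon>" using \<open>0 < \<epsilon>\<close> by simp
    moreover have "y \<in> Z i" using sub[of i j] y(1) by (auto simp: j_def)
    ultimately show "\<exists>y\<in>Z i. dist y x < \<epsilon>" by blast
  qed
  then have xZ: "x \<in> Z i" for i using \<open>\<And>i. closed (Z i)\<close> by simp
  have "\<exists>t. length t = i \<and> (\<forall>j<i. t ! j \<le> l j) \<and> (\<forall>m\<le>i. take m t = [] \<or> x \<in> A (take m t))" for i
  proof -
    obtain t where t: "t \<in> Box i" "\<And>m. m \<in> {1..i} \<Longrightarrow> x \<in> A (take m t)"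
      using xZ[of i] unfolding Z_def by blast
    have "take m t = [] \<or> x \<in> A (take m t)" if "m \<le> i" for m
      using t(2)[of m] that by (cases "m = 0") auto
    then show ?thesis using t(1) unfolding Box_def by blast
  qed
  \<comment> \<open>The disjunct for the empty list is needed because nothing is known about
    \<open>x\<close> and \<open>A []\<close>.\<close>
  then obtain \<sigma> where \<sigma>: "\<And>m. map \<sigma> [0..<m] = [] \<or> x \<in> A (map \<sigma> [0..<m])"
    using koenig_bounded[of l "\<lambda>s. s = [] \<or> x \<in> A s"] by blast
  have "x \<in> A (map \<sigma> [0..<Suc m])" for m using \<sigma>[of "Suc m"] by simp
  then show "x \<in> (\<Union>\<sigma>. \<Inter>m. A (map \<sigma> [0..<Suc m]))" by blast
qed

theorem theorem1p1:
  fixes E :: "(real ^ 'n) set" and k :: nat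
  assumes "1 \<le> k" and "k < CARD('n)"
    and "souslin E"
    and "\<not> hausdorff_sigma_finite k E"
  shows "\<exists>F. F \<subseteq> E \<and> closed F \<and> 0 < hausdorff_measure k F \<and> hausdorff_measure k F < \<infinity> \<and>
    purely_unrectifiable k F"
proof -
  obtain A :: "nat list \<Rightarrow> (real ^ 'n) set" where A: "\<And>s. closed (A s)"
    "E = (\<Union>\<sigma>. \<Inter>m. A (map \<sigma> [0..<Suc m]))"
    using assms(3) unfolding souslin_def by blast
  interpret N: net "cell :: nat \<times> (int ^ 'n) \<Rightarrow> _" fst "2 ^ k" "hausdorff_sigma_finite k"
    by (rule net_cell[OF assms(1)])
  have wr: "N.wr = wt k" by (simp add: fun_eq_iff N.wr_def wt_def)
  have mass: "N.mass = cell_mass k"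
    by (simp add: fun_eq_iff N.mass_def cell_mass_def N.below_def wr)
  have "\<not> hausdorff_sigma_finite k (branches A [])"
    using assms(4) unfolding branches_Nil A(2)[symmetric] .
  then show ?thesis
  proof (rule N.net_construction[OF branches_append incseq_branches])
    fix S :: "nat \<Rightarrow> (nat \<times> (int ^ 'n)) set" and l :: "nat \<Rightarrow> nat" and c :: real
    assume S: "\<And>i. finite (S i)"
      "\<And>i b. b \<in> S (Suc i) \<Longrightarrow> \<exists>a\<in>S i. N.below b a"
      and meets: "\<And>i b. b \<in> S i \<Longrightarrow> branches A (map l [0..<i]) \<inter> cell b \<noteq> {}"
      and S': "\<And>i b. b \<in> S i \<Longrightarrow> i \<le> fst b"
      "\<And>i Q. N.mass (S i) Q \<le> N.wr (fst Q)"
      "0 < c" "\<And>i. c \<le> (\<Sum>b\<in>S i. N.wr (fst b))"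
      "\<And>i j b. i < j \<Longrightarrow> b \<in> S j \<Longrightarrow> l i < fst b"
      "\<And>i j Q. i < j \<Longrightarrow> fst Q = l i \<Longrightarrow> N.mass (S j) Q \<le> N.wr (l i + i)"
    interpret T: cell_tower k S l c
      using assms(1) S S' by unfold_locales (simp_all add: wr mass N.below_def)
    have "T.limit_set \<subseteq> E" unfolding A(2) by (rule T.limit_set_subset_souslin[OF A(1) meets])
    then show ?thesis
      using T.closed_limit_set T.limit_set_positive_measure T.limit_set_finite_measure
        T.limit_set_purely_unrectifiable by blast
  qed
qed

end
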